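(* The diffeomorphism $f:\mathbb{T}^2\times[0,1]\to\mathbb{T}^2\times[0,1]$ defined by $$f(x,y,t)=\left(3x+y,\ 2x+y,\ t+\frac{t(1-t)}{32}\cos(2\pi x)\right)$$ is topologically transitive.
   Context: $\mathbb{T}^2=\mathbb{R}^2/\mathbb{Z}^2$, with coordinates $(x,y)$ taken mod $1$, and $t\in[0,1]$. A continuous map $f:M\to M$ is topologically transitive if for any two nonempty open sets $U,V\subseteq M$ there is a positive integer $m$ with $f^m(U)\cap V\neq\varnothing$. *)

theory Defs
  imports "HOL-Analysis.Analysis"
begin

definition torus_rel :: "real \<times> real \<Rightarrow> real \<times> real \<Rightarrow> bool" where
  "torus_rel p q \<longleftrightarrow> fst p - fst q \<in> \<int> \<and> snd p - snd q \<in> \<int>"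

lemma equivp_torus_rel: "equivp torus_rel"
proof (rule equivpI)
  show "reflp torus_rel"
    by (simp add: reflp_def torus_rel_def)
  show "symp torus_rel"
    unfolding symp_def torus_rel_def by (metis Ints_minus minus_diff_eq)
  show "transp torus_rel"
    unfolding transp_def torus_rel_def by (metis Ints_add diff_add_cancel add_diff_eq)
qed

quotient_type torus = "real \<times> real" / torus_rel
  by (rule equivp_torus_rel)

text \<open>The torus carries the quotient topology; \<open>abs_torus\<close> is the projection from the plane.\<close>

instantiation torus :: topological_space
begin

definition open_torus :: "torus set \<Rightarrow> bool" where
  "open_torus U \<longleftrightarrow> open (abs_torus -` U)"

instance
  by standard (auto simp: open_torus_def vimage_Union intro: open_Int open_UN)

end

definition slab :: "(torus \<times> real) set" where
  "slab = UNIV \<times> {0..1}"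

definition slab_proj :: "(real \<times> real) \<times> real \<Rightarrow> torus \<times> real" where
  "slab_proj = (\<lambda>(p, t). (abs_torus p, t))"

lift_definition torus_auto :: "torus \<Rightarrow> torus" is "\<lambda>(x, y). (3 * x + y, 2 * x + y)"
proof -
  fix p q :: "real \<times> real"
  assume "torus_rel p q"
  then obtain m n where mn: "fst p - fst q = of_int m" "snd p - snd q = of_int n"
    unfolding torus_rel_def by (auto elim!: Ints_cases)
  have "3 * fst p + snd p - (3 * fst q + snd q) = of_int (3 * m + n)"
    "2 * fst p + snd p - (2 * fst q + snd q) = of_int (2 * m + n)"
    using mn by simp_all
  then show "torus_rel (case p of (x, y) \<Rightarrow> (3 * x + y, 2 * x + y))
      (case q of (x, y) \<Rightarrow> (3 * x + y, 2 * x + y))"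
    unfolding torus_rel_def by (simp only: case_prod_unfold fst_conv snd_conv Ints_of_int simp_thms)
qed

lift_definition torus_cos :: "torus \<Rightarrow> real" is "\<lambda>(x, y). cos (2 * pi * x)"
proof -
  fix p q :: "real \<times> real"
  assume "torus_rel p q"
  then obtain m where m: "fst p = fst q + of_int m"
    unfolding torus_rel_def by (metis Ints_cases add.commute diff_add_cancel)
  have "cos (2 * pi * fst p) = cos (2 * pi * fst q + 2 * pi * of_int m)"
    by (simp add: m algebra_simps)
  also have "\<dots> = cos (2 * pi * fst q)"
    by (simp add: cos_add)
  finally show "(case p of (x, y) \<Rightarrow> cos (2 * pi * x)) = (case q of (x, y) \<Rightarrow> cos (2 * pi * x))"
    by (simp add: case_prod_unfold)
qed

definition skew_map :: "torus \<times> real \<Rightarrow> torus \<times> real" where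
  "skew_map = (\<lambda>(p, t). (torus_auto p, t + t * (1 - t) / 32 * torus_cos p))"

lemma skew_map_eq:
  "skew_map (abs_torus (x, y), t) =
     (abs_torus (3 * x + y, 2 * x + y), t + t * (1 - t) / 32 * cos (2 * pi * x))"
  by (simp add: skew_map_def torus_auto.abs_eq torus_cos.abs_eq)

text \<open>Class \<open>C\<^sup>n\<close> on an open set, by recursion on directional derivatives.\<close>

fun Cn_on :: "nat \<Rightarrow> 'a::real_normed_vector set \<Rightarrow> ('a \<Rightarrow> 'b::real_normed_vector) \<Rightarrow> bool" where
  "Cn_on 0 S g \<longleftrightarrow> continuous_on S g"
| "Cn_on (Suc n) S g \<longleftrightarrow>
     (\<forall>x\<in>S. g differentiable (at x)) \<and>
     (\<forall>v. Cn_on n S (\<lambda>x. frechet_derivative g (at x) v))"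

definition smooth_on :: "'a::real_normed_vector set \<Rightarrow> ('a \<Rightarrow> 'b::real_normed_vector) \<Rightarrow> bool" where
  "smooth_on S g \<longleftrightarrow> (\<forall>n. Cn_on n S g)"

text \<open>Local inverses of \<open>slab_proj\<close> are the charts of the manifold with boundary \<open>slab\<close>, so
  smoothness means that coordinate expressions extend, near each point of
  \<open>UNIV \<times> {0..1}\<close> (boundary points included), to smooth maps on an open set.\<close>

definition slab_smooth :: "(torus \<times> real \<Rightarrow> torus \<times> real) \<Rightarrow> bool" where
  "slab_smooth g \<longleftrightarrow> g ` slab \<subseteq> slab \<and>
     (\<forall>z \<in> UNIV \<times> {0..1}. \<exists>W G. open W \<and> z \<in> W \<and> smooth_on W G \<and>
        (\<forall>w \<in> W \<inter> UNIV \<times> {0..1}. g (slab_proj w) = slab_proj (G w)))"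

definition slab_diffeomorphism :: "(torus \<times> real \<Rightarrow> torus \<times> real) \<Rightarrow> bool" where
  "slab_diffeomorphism g \<longleftrightarrow>
     bij_betw g slab slab \<and> slab_smooth g \<and> slab_smooth (inv_into slab g)"

definition topologically_transitive_on ::
    "'a::topological_space set \<Rightarrow> ('a \<Rightarrow> 'a) \<Rightarrow> bool" where
  "topologically_transitive_on M g \<longleftrightarrow>
     continuous_on M g \<and> g ` M \<subseteq> M \<and>
     (\<forall>U V. openin (top_of_set M) U \<and> U \<noteq> {} \<and> openin (top_of_set M) V \<and> V \<noteq> {} \<longrightarrow>
        (\<exists>m>0. (g ^^ m) ` U \<inter> V \<noteq> {}))"

end

theory Submission imports Defs begin

text \<open>
  In the logit coordinate \<open>x = ln (t / (1 - t))\<close> every fibre map over \<open>0 < t < 1\<close> is weakly expanding: it moves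
  points up by a definite amount over base points near \<open>(0, 0)\<close>, down near \<open>(1/2, 0)\<close>, and strictly expands
  near \<open>(0, 0)\<close> when \<open>x\<close> is bounded. Base orbits that linger near \<open>(1/2, 0)\<close> and then follow a heteroclinic
  point to \<open>(0, 0)\<close> push a fibre interval down and lift it again through the expanding zone, so over
  any open set of base points the images of a given interval become arbitrarily long. Finally, pull
  a target height back along orbits spending \<open>n\<close> steps near \<open>(1/2, 0)\<close> and \<open>k\<close> steps near \<open>(0, 0)\<close> before
  reaching the target. As backward maps contract, passing from \<open>k\<close> to \<open>k + 1\<close> moves the pulled-back height
  by an amount depending only on the target, while over all \<open>k\<close> it sweeps from above to below the long
  interval; hence it lands inside.

  Smoothness of the inverse uses the explicit root of the quadratic fibre equation.
\<close>

section \<open>The skew product is a diffeomorphism\<close>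

text \<open>A class closed under directional derivatives, so that all orders of smoothness follow
  from one syntactic check. The \<open>powr\<close> rule, with an arbitrary real exponent, supplies
  both square roots and reciprocals of positive functions.\<close>

inductive elementary_on :: "'a::real_normed_vector set \<Rightarrow> ('a \<Rightarrow> real) \<Rightarrow> bool" for S where
  elementary_const: "elementary_on S (\<lambda>_. c)"
| elementary_linear: "bounded_linear f \<Longrightarrow> elementary_on S f"
| elementary_add: "elementary_on S f \<Longrightarrow> elementary_on S g \<Longrightarrow> elementary_on S (\<lambda>x. f x + g x)"
| elementary_mult: "elementary_on S f \<Longrightarrow> elementary_on S g \<Longrightarrow> elementary_on S (\<lambda>x. f x * g x)"
| elementary_cos: "elementary_on S f \<Longrightarrow> elementary_on S (\<lambda>x. cos (f x))"
| elementary_sin: "elementary_on S f \<Longrightarrow> elementary_on S (\<lambda>x. sin (f x))"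
| elementary_powr: "elementary_on S f \<Longrightarrow> (\<forall>x\<in>S. 0 < f x) \<Longrightarrow> elementary_on S (\<lambda>x. f x powr a)"

lemma elementary_diff:
  assumes "elementary_on S f" "elementary_on S g"
  shows "elementary_on S (\<lambda>x. f x - g x)"
  using elementary_add [OF assms(1) elementary_mult [OF elementary_const [of S "-1"] assms(2)]] by simp

text \<open>Structural induction with the usual differentiation rules. The second conjunct is the
  point: each directional derivative is again elementary, so differentiation can be
  repeated.\<close>

lemma elementary_derivative:
  assumes "elementary_on S f"
  shows "\<exists>f'. (\<forall>x\<in>S. (f has_derivative f' x) (at x)) \<and> (\<forall>v. elementary_on S (\<lambda>x. f' x v))"
  using assms
proof induction
  case (elementary_const c)
  have "((\<lambda>_. c) has_derivative (\<lambda>_. 0)) (at x)" for x :: 'a by simp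
  then show ?case by (intro exI [of _ "\<lambda>_ _. 0"]) (auto intro: elementary_on.elementary_const)
next
  case (elementary_linear f)
  then show ?case
    by (intro exI [of _ "\<lambda>_. f"]) (auto intro: elementary_on.elementary_const bounded_linear_imp_has_derivative)
next
  case (elementary_add f g)
  then obtain f' g' where *: "\<forall>x\<in>S. (f has_derivative f' x) (at x)" "\<forall>x\<in>S. (g has_derivative g' x) (at x)"
    "\<forall>v. elementary_on S (\<lambda>x. f' x v)" "\<forall>v. elementary_on S (\<lambda>x. g' x v)" by blast
  then show ?case
    by (intro exI [of _ "\<lambda>x v. f' x v + g' x v"])
      (auto intro!: derivative_intros elementary_on.elementary_add)
next
  case (elementary_mult f g)
  then obtain f' g' where *: "\<forall>x\<in>S. (f has_derivative f' x) (at x)" "\<forall>x\<in>S. (g has_derivative g' x) (at x)"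
    "\<forall>v. elementary_on S (\<lambda>x. f' x v)" "\<forall>v. elementary_on S (\<lambda>x. g' x v)" by blast
  with elementary_mult show ?case
    by (intro exI [of _ "\<lambda>x v. f x * g' x v + f' x v * g x"])
      (auto intro!: derivative_intros elementary_on.elementary_add elementary_on.elementary_mult)
next
  case (elementary_cos f)
  then obtain f' where *: "\<forall>x\<in>S. (f has_derivative f' x) (at x)" "\<forall>v. elementary_on S (\<lambda>x. f' x v)" by blast
  have "elementary_on S (\<lambda>x. f' x v * (-1 * sin (f x)))" for v
    using * elementary_cos
    by (intro elementary_on.elementary_mult elementary_on.elementary_sin elementary_on.elementary_const) auto
  with * show ?case
    by (intro exI [of _ "\<lambda>x v. f' x v * (-1 * sin (f x))"])
      (auto intro!: has_derivative_cos [THEN has_derivative_eq_rhs])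
next
  case (elementary_sin f)
  then obtain f' where *: "\<forall>x\<in>S. (f has_derivative f' x) (at x)" "\<forall>v. elementary_on S (\<lambda>x. f' x v)" by blast
  have "elementary_on S (\<lambda>x. f' x v * cos (f x))" for v
    using * elementary_sin
    by (intro elementary_on.elementary_mult elementary_on.elementary_cos) auto
  with * show ?case
    by (intro exI [of _ "\<lambda>x v. f' x v * cos (f x)"])
      (auto intro!: has_derivative_sin [THEN has_derivative_eq_rhs])
next
  case (elementary_powr f a)
  then obtain f' where *: "\<forall>x\<in>S. (f has_derivative f' x) (at x)" "\<forall>v. elementary_on S (\<lambda>x. f' x v)" by blast
  have "elementary_on S (\<lambda>x. a * (f' x v * f x powr (a - 1)))" for v
    using * elementary_powr
    by (intro elementary_on.elementary_mult elementary_on.elementary_powr elementary_on.elementary_const) auto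
  moreover have "((\<lambda>x. f x powr a) has_derivative (\<lambda>v. a * (f' x v * f x powr (a - 1)))) (at x)"
    if "x \<in> S" for x
  proof -
    have "0 < f x" using elementary_powr that by auto
    have "(f has_derivative f' x) (at x)" using * that by auto
    from has_derivative_powr [OF this has_derivative_const [of a] \<open>0 < f x\<close>] 
    show ?thesis
      by (rule has_derivative_eq_rhs) (use \<open>0 < f x\<close> in \<open>simp_all add: fun_eq_iff powr_diff field_simps\<close>)
  qed
  ultimately show ?case by (intro exI [of _ "\<lambda>x v. a * (f' x v * f x powr (a - 1))"]) auto
qed

text \<open>Derivatives are local, so on an open set agreement of the functions passes to their
  derivatives. This allows \<open>frechet_derivative\<close> to be replaced by an explicit formula
  known only on \<open>S\<close>.\<close>

lemma Cn_on_cong: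
  assumes "open S" "\<And>x. x \<in> S \<Longrightarrow> f x = g x"
  shows "Cn_on n S f \<longleftrightarrow> Cn_on n S g"
  using assms(2)
proof (induction n arbitrary: f g)
  case 0
  then show ?case using continuous_on_cong [of S S f g] by simp
next
  case (Suc n)
  have d: "(f has_derivative D) (at x) \<longleftrightarrow> (g has_derivative D) (at x)" if "x \<in> S" for x D
    using that Suc.prems assms(1)
    by (metis has_derivative_transform_within_open)
  then have "frechet_derivative f (at x) = frechet_derivative g (at x)" if "x \<in> S" for x
    using that by (simp add: frechet_derivative_def)
  then have "Cn_on n S (\<lambda>x. frechet_derivative f (at x) v) = Cn_on n S (\<lambda>x. frechet_derivative g (at x) v)" for v
    by (intro Suc.IH) auto
  with d show ?case by (simp add: differentiable_def)
qed

lemma Cn_on_elementary: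
  assumes "open S" "elementary_on S f"
  shows "Cn_on n S f"
  using assms(2)
proof (induction n arbitrary: f)
  case 0
  obtain f' where "\<forall>x\<in>S. (f has_derivative f' x) (at x)"
    using elementary_derivative [OF 0] by blast
  then show ?case
    by (auto intro!: continuous_at_imp_continuous_on has_derivative_continuous)
next
  case (Suc n)
  obtain f' where f': "\<forall>x\<in>S. (f has_derivative f' x) (at x)" "\<forall>v. elementary_on S (\<lambda>x. f' x v)"
    using elementary_derivative [OF Suc.prems] by blast
  have "Cn_on n S (\<lambda>x. frechet_derivative f (at x) v)" for v
  proof -
    have "frechet_derivative f (at x) v = f' x v" if "x \<in> S" for x
      using f' that frechet_derivative_at by metis
    then show ?thesis
      using Suc.IH [of "\<lambda>x. f' x v"] f'
        Cn_on_cong [OF assms(1), of "\<lambda>x. frechet_derivative f (at x) v" "\<lambda>x. f' x v"] by simp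
  qed
  with f' show ?case by (auto simp: differentiable_def)
qed

lemma Cn_on_Pair:
  assumes "open S" "Cn_on n S f" "Cn_on n S g"
  shows "Cn_on n S (\<lambda>x. (f x, g x))"
  using assms(2,3)
proof (induction n arbitrary: f g)
  case 0
  then show ?case by (simp add: continuous_on_Pair)
next
  case (Suc n)
  have *: "((\<lambda>x. (f x, g x)) has_derivative
      (\<lambda>v. (frechet_derivative f (at x) v, frechet_derivative g (at x) v))) (at x)" if "x \<in> S" for x
    using Suc.prems that by (intro has_derivative_Pair) (auto simp: frechet_derivative_works [symmetric])
  have "Cn_on n S (\<lambda>x. frechet_derivative (\<lambda>x. (f x, g x)) (at x) v)" for v
  proof -
    have "frechet_derivative (\<lambda>x. (f x, g x)) (at x) v
        = (frechet_derivative f (at x) v, frechet_derivative g (at x) v)" if "x \<in> S" for x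
      using frechet_derivative_at [OF * [OF that], symmetric] by simp
    moreover have "Cn_on n S (\<lambda>x. (frechet_derivative f (at x) v, frechet_derivative g (at x) v))"
      using Suc.prems by (intro Suc.IH) auto
    ultimately show ?thesis
      using Cn_on_cong [OF assms(1), of "\<lambda>x. frechet_derivative (\<lambda>x. (f x, g x)) (at x) v"
          "\<lambda>x. (frechet_derivative f (at x) v, frechet_derivative g (at x) v)"] by simp
  qed
  with * show ?case by (auto simp: differentiable_def)
qed

lemma smooth_on_elementary_triple:
  assumes "open S" "elementary_on S f" "elementary_on S g" "elementary_on S h"
  shows "smooth_on S (\<lambda>x. ((f x, g x), h x))"
  using assms by (auto simp: smooth_on_def intro!: Cn_on_Pair Cn_on_elementary)

text \<open>Root of \<open>t + t * (1 - t) * \<theta> = s\<close>; the rationalised form stays valid at \<open>\<theta> = 0\<close>.\<close>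

definition fiber_inverse :: "real \<Rightarrow> real \<Rightarrow> real" where
  "fiber_inverse \<theta> s = 2 * s / (1 + \<theta> + sqrt ((1 + \<theta>)\<^sup>2 - 4 * \<theta> * s))"

text \<open>The interval for \<open>s\<close> is a neighbourhood of the unit interval, so the
  inverse formula extends smoothly across both boundary components.\<close>

lemma fiber_discriminant_pos:
  assumes "\<bar>\<theta>\<bar> \<le> 1 / 32" "-1 < s" "s < (2::real)"
  shows "0 < (1 + \<theta>)\<^sup>2 - 4 * \<theta> * s"
proof -
  have "\<bar>\<theta> * s\<bar> \<le> (1 / 32) * 2" unfolding abs_mult using assms by (intro mult_mono) auto
  then have "4 * \<theta> * s \<le> 1 / 4" by linarith
  moreover have "(31 / 32)\<^sup>2 \<le> (1 + \<theta>)\<^sup>2" using assms by (intro power_mono) auto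
  ultimately show ?thesis by (simp add: power2_eq_square)
qed

lemma fiber_inverse_right:
  assumes "\<bar>\<theta>\<bar> \<le> 1 / 32" "-1 < s" "s < 2"
  shows "fiber_inverse \<theta> s + fiber_inverse \<theta> s * (1 - fiber_inverse \<theta> s) * \<theta> = s"
proof -
  define r where "r = sqrt ((1 + \<theta>)\<^sup>2 - 4 * \<theta> * s)"
  have r2: "r\<^sup>2 = (1 + \<theta>)\<^sup>2 - 4 * \<theta> * s" and r: "0 < r"
    using fiber_discriminant_pos [OF assms] by (auto simp: r_def)
  have d: "0 < 1 + \<theta> + r" using assms r by linarith
  define X where "X = fiber_inverse \<theta> s"
  have X: "X * (1 + \<theta> + r) = 2 * s"
    using d by (simp add: X_def fiber_inverse_def r_def [symmetric])
  \<comment> \<open>The factor \<open>(1 + \<theta> + r)\<^sup>2\<close> clears the denominators,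
    leaving a polynomial consequence of \<open>r2\<close> and \<open>X\<close>.\<close>
  have "(X + X * (1 - X) * \<theta> - s) * (1 + \<theta> + r)\<^sup>2 = 0"
    using r2 X by algebra
  then show ?thesis using d by (simp add: X_def)
qed

text \<open>The difference of the two sides factors as
  \<open>(u - t) * (1 + \<theta> * (1 - t - u))\<close>, and the second factor is positive because
  \<open>1 - t - u\<close> has absolute value at most 1.\<close>

lemma fiber_map_strict_mono:
  assumes "\<bar>\<theta>\<bar> \<le> 1 / 32" "0 \<le> t" "t < u" "u \<le> (1::real)"
  shows "t + t * (1 - t) * \<theta> < u + u * (1 - u) * \<theta>"
proof -
  have "\<bar>\<theta> * (1 - t - u)\<bar> \<le> (1 / 32) * 1" unfolding abs_mult using assms by (intro mult_mono) auto
  then have "0 < (u - t) * (1 + \<theta> * (1 - t - u))" using assms by (intro mult_pos_pos) auto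
  then show ?thesis by (simp add: algebra_simps)
qed

lemma fiber_map_in_unit:
  assumes "\<bar>\<theta>\<bar> \<le> 1 / 32" "0 \<le> t" "t \<le> (1::real)"
  shows "0 \<le> t + t * (1 - t) * \<theta>" "t + t * (1 - t) * \<theta> \<le> 1"
proof -
  have "t = 0 \<or> 0 < t" "t = 1 \<or> t < 1" using assms by auto
  then show "0 \<le> t + t * (1 - t) * \<theta>" "t + t * (1 - t) * \<theta> \<le> 1"
    using fiber_map_strict_mono [OF assms(1), of 0 t] fiber_map_strict_mono [OF assms(1), of t 1] assms by force+
qed

lemma fiber_inverse_in_unit:
  assumes "\<bar>\<theta>\<bar> \<le> 1 / 32" "0 \<le> s" "s \<le> 1"
  shows "0 \<le> fiber_inverse \<theta> s" "fiber_inverse \<theta> s \<le> 1"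
proof -
  define r where "r = sqrt ((1 + \<theta>)\<^sup>2 - 4 * \<theta> * s)"
  have r: "0 < r" and r2: "r\<^sup>2 = (1 + \<theta>)\<^sup>2 - 4 * \<theta> * s"
    using fiber_discriminant_pos [OF assms(1), of s] assms by (auto simp: r_def)
  show "0 \<le> fiber_inverse \<theta> s" using assms r
    unfolding fiber_inverse_def r_def [symmetric] by (auto intro!: divide_nonneg_pos)
  \<comment> \<open>This is the upper bound 1 with the denominator cleared; the squares of the two
    sides differ by \<open>4 * s * (1 - s)\<close>.\<close>
  have "2 * s - (1 + \<theta>) \<le> r"
  proof (rule power2_le_imp_le)
    have "0 \<le> 4 * s * (1 - s)" using assms by (intro mult_nonneg_nonneg) auto
    then show "(2 * s - (1 + \<theta>))\<^sup>2 \<le> r\<^sup>2" unfolding r2 by (simp add: power2_eq_square algebra_simps)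
  qed (use r in auto)
  then show "fiber_inverse \<theta> s \<le> 1" using assms r
    unfolding fiber_inverse_def r_def [symmetric] by (auto simp: divide_le_eq)
qed

text \<open>A right inverse of an injective map is also a left inverse; injectivity comes from
  strict monotonicity.\<close>

lemma fiber_inverse_left:
  assumes "\<bar>\<theta>\<bar> \<le> 1 / 32" "0 \<le> t" "t \<le> 1"
  shows "fiber_inverse \<theta> (t + t * (1 - t) * \<theta>) = t"
proof -
  define s where "s = t + t * (1 - t) * \<theta>"
  have s: "0 \<le> s" "s \<le> 1" unfolding s_def using fiber_map_in_unit [OF assms] by auto
  have "fiber_inverse \<theta> s + fiber_inverse \<theta> s * (1 - fiber_inverse \<theta> s) * \<theta> = s"
    using s assms by (intro fiber_inverse_right) auto
  moreover have "0 \<le> fiber_inverse \<theta> s" "fiber_inverse \<theta> s \<le> 1"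
    using fiber_inverse_in_unit [OF assms(1) s] by auto
  ultimately show ?thesis
    using fiber_map_strict_mono [OF assms(1), of "fiber_inverse \<theta> s" t]
      fiber_map_strict_mono [OF assms(1), of t "fiber_inverse \<theta> s"] assms
    unfolding s_def by (cases "fiber_inverse \<theta> s" t rule: linorder_cases) (auto simp: s_def)
qed

section \<open>The inverse skew product and its smoothness\<close>

text \<open>The matrix of \<open>torus_auto\<close> has determinant 1, so its inverse is again
  integral and descends to the torus.\<close>

lift_definition torus_auto_inv :: "torus \<Rightarrow> torus" is "\<lambda>(x, y). (x - y, 3 * y - 2 * x)"
proof -
  fix p q :: "real \<times> real"
  assume "torus_rel p q"
  then obtain m n where mn: "fst p - fst q = of_int m" "snd p - snd q = of_int n"
    unfolding torus_rel_def by (auto elim!: Ints_cases)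
  have "fst p - snd p - (fst q - snd q) = of_int (m - n)"
    "3 * snd p - 2 * fst p - (3 * snd q - 2 * fst q) = of_int (3 * n - 2 * m)"
    using mn by simp_all
  then show "torus_rel (case p of (x, y) \<Rightarrow> (x - y, 3 * y - 2 * x))
      (case q of (x, y) \<Rightarrow> (x - y, 3 * y - 2 * x))"
    unfolding torus_rel_def by (simp only: case_prod_unfold fst_conv snd_conv Ints_of_int simp_thms)
qed

lemma abs_torus_cases: obtains x y where "b = abs_torus (x, y)"
proof -
  obtain p where "b = abs_torus p" using torus.abs_induct [of "\<lambda>b. \<exists>p. b = abs_torus p" b] by blast
  then show ?thesis using that by (cases p) auto
qed

lemma torus_auto_inverse [simp]:
  "torus_auto_inv (torus_auto b) = b" "torus_auto (torus_auto_inv b) = b"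
  by (cases b rule: abs_torus_cases; simp add: torus_auto.abs_eq torus_auto_inv.abs_eq algebra_simps)+

lemma torus_cos_bound: "\<bar>torus_cos b / 32\<bar> \<le> 1 / 32"
  by (cases b rule: abs_torus_cases) (simp add: torus_cos.abs_eq)

definition skew_inv :: "torus \<times> real \<Rightarrow> torus \<times> real" where
  "skew_inv = (\<lambda>(b, s). (torus_auto_inv b, fiber_inverse (torus_cos (torus_auto_inv b) / 32) s))"

lemma skew_map_alt: "skew_map (b, t) = (torus_auto b, t + t * (1 - t) * (torus_cos b / 32))"
  by (simp add: skew_map_def)

lemma skew_map_slab: "z \<in> slab \<Longrightarrow> skew_map z \<in> slab"
  using fiber_map_in_unit [OF torus_cos_bound] by (cases z) (auto simp: slab_def skew_map_alt)

lemma skew_inv_slab: "z \<in> slab \<Longrightarrow> skew_inv z \<in> slab"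
  using fiber_inverse_in_unit [OF torus_cos_bound] by (cases z) (auto simp: slab_def skew_inv_def)

lemma skew_inv_left: "z \<in> slab \<Longrightarrow> skew_inv (skew_map z) = z"
  using fiber_inverse_left [OF torus_cos_bound] by (cases z) (auto simp: slab_def skew_map_alt skew_inv_def)

lemma skew_inv_right: "z \<in> slab \<Longrightarrow> skew_map (skew_inv z) = z"
  using fiber_inverse_right [OF torus_cos_bound]
  by (cases z) (auto simp: slab_def skew_map_alt skew_inv_def)

lemma bij_betw_skew_map: "bij_betw skew_map slab slab"
  by (rule bij_betw_byWitness [where f' = skew_inv])
    (auto simp: skew_inv_left skew_inv_right skew_map_slab skew_inv_slab)

lemma inv_into_skew_map: "z \<in> slab \<Longrightarrow> inv_into slab skew_map z = skew_inv z"
  using bij_betw_skew_map skew_inv_right skew_inv_slab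
  by (intro inv_into_f_eq) (auto simp: bij_betw_def)

text \<open>A single global lift \<open>G\<close> serves at every point, so no local choice of
  charts is needed.\<close>

lemma slab_smoothI:
  assumes "g ` slab \<subseteq> slab" "open W" "UNIV \<times> {0..1} \<subseteq> W" "smooth_on W G"
    "\<And>w. w \<in> UNIV \<times> {0..1} \<Longrightarrow> g (slab_proj w) = slab_proj (G w)"
  shows "slab_smooth g"
  unfolding slab_smooth_def using assms by (intro conjI ballI exI [of _ W] exI [of _ G]) blast+

lemma elementary_coord:
  "elementary_on S (\<lambda>w::(real \<times> real) \<times> real. fst (fst w))"
  "elementary_on S (\<lambda>w::(real \<times> real) \<times> real. snd (fst w))"
  "elementary_on S (\<lambda>w::(real \<times> real) \<times> real. snd w)"
  by (intro elementary_linear bounded_linear_fst_comp bounded_linear_snd_comp bounded_linear_fst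
      bounded_linear_snd bounded_linear_ident)+

lemmas elementary_intros =
  elementary_const elementary_add elementary_diff elementary_mult elementary_cos elementary_coord

lemma slab_smooth_skew_map: "slab_smooth skew_map"
proof (rule slab_smoothI)
  show "smooth_on UNIV (\<lambda>w. ((3 * fst (fst w) + snd (fst w), 2 * fst (fst w) + snd (fst w)),
      snd w + snd w * (1 - snd w) * (1 / 32) * cos (2 * pi * fst (fst w))))"
    by (intro smooth_on_elementary_triple elementary_intros open_UNIV)
qed (auto simp: slab_proj_def skew_map_eq skew_map_slab)

lemma slab_smooth_skew_inv: "slab_smooth (inv_into slab skew_map)"
proof (rule slab_smoothI)
  \<comment> \<open>The lift is defined beyond the boundary, on a strip where the discriminant
    \<open>D\<close> stays positive. Root and quotient are written with \<open>powr\<close> to fit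
    \<open>elementary_on\<close>.\<close>
  let ?W = "(UNIV :: (real \<times> real) set) \<times> {-1<..<2::real}"
  define th :: "(real \<times> real) \<times> real \<Rightarrow> real"
    where "th = (\<lambda>w. 1 / 32 * cos (2 * pi * (fst (fst w) - snd (fst w))))"
  define D where "D = (\<lambda>w. (1 + th w) * (1 + th w) - 4 * th w * snd w)"
  have th: "\<bar>th w\<bar> \<le> 1 / 32" for w by (simp add: th_def abs_mult)
  have D: "0 < D w" if "w \<in> ?W" for w
    using fiber_discriminant_pos [OF th, of "snd w" w] that by (cases w) (auto simp: D_def power2_eq_square)
  have eth: "elementary_on ?W th" unfolding th_def by (intro elementary_intros)
  have eD: "elementary_on ?W D"
    unfolding D_def by (intro elementary_intros eth)
  have eR: "elementary_on ?W (\<lambda>w. D w powr (1 / 2))"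
    using D by (intro elementary_powr [OF eD]) blast
  have pos: "0 < 1 + th w + D w powr (1 / 2)" for w
    using th [of w] powr_ge_zero [of "D w" "1 / 2"] by linarith
  have e: "elementary_on ?W (\<lambda>w. (1 + th w + D w powr (1 / 2)) powr (-1))"
    using pos by (intro elementary_powr [OF elementary_add [OF elementary_add [OF elementary_const eth] eR]]) blast
  let ?G = "\<lambda>w. ((fst (fst w) - snd (fst w), 3 * snd (fst w) - 2 * fst (fst w)),
      2 * snd w * (1 + th w + D w powr (1 / 2)) powr (-1))"
  show "smooth_on ?W ?G"
    by (intro smooth_on_elementary_triple elementary_intros e open_Times open_UNIV open_greaterThanLessThan)
  show "inv_into slab skew_map (slab_proj w) = slab_proj (?G w)" if "w \<in> UNIV \<times> {0..1}" for w
  proof -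
    obtain p s where "w = (p, s)" by (cases w)
    then obtain x y where w: "w = ((x, y), s)" by (cases p) auto
    have Dw: "D w = (1 + th w) * (1 + th w) - 4 * th w * s" by (simp add: D_def w)
    have "0 < D w" using that w by (intro D) auto
    then have "sqrt ((1 + th w)\<^sup>2 - 4 * th w * s) = D w powr (1 / 2)"
      by (simp only: powr_half_sqrt [OF less_imp_le] Dw power2_eq_square)
    moreover have "(1 + th w + D w powr (1 / 2)) powr (-1) = 1 / (1 + th w + D w powr (1 / 2))"
      using pos [of w] by (simp add: powr_minus_divide)
    ultimately have "fiber_inverse (th w) s = 2 * s * (1 + th w + D w powr (1 / 2)) powr (-1)"
      by (simp only: fiber_inverse_def times_divide_eq_right mult_1_right)
    moreover have "slab_proj w \<in> slab" using that by (auto simp: slab_proj_def slab_def)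
    moreover have "torus_cos (torus_auto_inv (abs_torus (x, y))) / 32 = th w"
      by (simp add: torus_auto_inv.abs_eq torus_cos.abs_eq th_def w)
    ultimately show ?thesis
      by (simp add: inv_into_skew_map slab_proj_def skew_inv_def torus_auto_inv.abs_eq w)
  qed
  show "inv_into slab skew_map ` slab \<subseteq> slab"
    by (auto simp: inv_into_skew_map skew_inv_slab)
  show "open ?W" by (intro open_Times open_UNIV open_greaterThanLessThan)
  show "UNIV \<times> {0..1} \<subseteq> ?W" by auto
qed

lemma slab_diffeomorphism_skew_map: "slab_diffeomorphism skew_map"
  by (simp add: slab_diffeomorphism_def bij_betw_skew_map slab_smooth_skew_map slab_smooth_skew_inv)

section \<open>Fibre maps in the logit coordinate\<close>

definition logistic :: "real \<Rightarrow> real" where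
  "logistic x = exp x / (1 + exp x)"

text \<open>The fibre map with parameter \<open>\<theta>\<close>, conjugated by
  \<open>logistic\<close>.\<close>

definition logit_step :: "real \<Rightarrow> real \<Rightarrow> real" where
  "logit_step \<theta> x = x + ln (1 + \<theta> + exp x) - ln (1 + (1 - \<theta>) * exp x)"

lemma logistic_bounds: "0 < logistic x" "logistic x < 1"
  by (auto simp: logistic_def add_pos_pos)

lemma logistic_surj:
  assumes "0 < t" "t < 1"
  obtains x where "logistic x = t"
proof
  have "1 + t / (1 - t) = 1 / (1 - t)" using assms by (simp add: field_simps)
  then show "logistic (ln (t / (1 - t))) = t"
    using assms by (simp add: logistic_def)
qed

lemma exp_logit_step:
  assumes "\<bar>\<theta>\<bar> \<le> 1 / 32"
  shows "exp (logit_step \<theta> x) = exp x * (1 + \<theta> + exp x) / (1 + (1 - \<theta>) * exp x)"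
proof -
  have "0 < 1 + \<theta> + exp x" using assms exp_gt_zero [of x] by linarith
  moreover have "0 < 1 + (1 - \<theta>) * exp x" using assms by (intro add_pos_pos mult_pos_pos) auto
  ultimately show ?thesis by (simp add: logit_step_def exp_add exp_diff)
qed

lemma logistic_logit_step:
  assumes "\<bar>\<theta>\<bar> \<le> 1 / 32"
  shows "logistic (logit_step \<theta> x) = logistic x + logistic x * (1 - logistic x) * \<theta>"
proof -
  define s where "s = exp x"
  have s: "0 < s" by (simp add: s_def)
  have p: "0 < 1 + s" "0 < 1 + \<theta> + s" "0 < 1 + (1 - \<theta>) * s"
    using assms s by (auto intro!: add_pos_pos mult_pos_pos)
  \<comment> \<open>The denominator of \<open>logistic\<close> at the image point becomes a perfect
    square over the same quantity, which then cancels.\<close>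
  have e: "1 + s * (1 + \<theta> + s) / (1 + (1 - \<theta>) * s) = (1 + s)\<^sup>2 / (1 + (1 - \<theta>) * s)"
    using p by (simp add: field_simps power2_eq_square)
  have "logistic (logit_step \<theta> x) = s * (1 + \<theta> + s) / (1 + s)\<^sup>2"
    unfolding logistic_def exp_logit_step [OF assms] s_def [symmetric] e using p by simp
  also have "\<dots> = logistic x + logistic x * (1 - logistic x) * \<theta>"
  proof -
    have "1 - s / (1 + s) = 1 / (1 + s)" using p by (simp add: field_simps)
    then show ?thesis unfolding logistic_def s_def [symmetric]
      using p by (simp add: power2_eq_square divide_simps) (simp add: algebra_simps)
  qed
  finally show ?thesis .
qed

text \<open>The increment of \<open>logit_step \<theta>\<close> is the logarithm of this ratio at \<open>exp x\<close>.\<close>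

definition logit_ratio :: "real \<Rightarrow> real \<Rightarrow> real" where
  "logit_ratio \<theta> s = (1 + \<theta> + s) / (1 + (1 - \<theta>) * s)"

lemma logit_step_eq:
  assumes "\<bar>\<theta>\<bar> \<le> 1 / 32"
  shows "logit_step \<theta> x = x + ln (logit_ratio \<theta> (exp x))"
proof -
  have "0 < 1 + \<theta> + exp x" using assms exp_gt_zero [of x] by linarith
  moreover have "0 < 1 + (1 - \<theta>) * exp x" using assms by (intro add_pos_pos mult_pos_pos) auto
  ultimately show ?thesis by (simp add: logit_step_def logit_ratio_def ln_div)
qed

text \<open>The parameter enters only through its square in the numerator, so the ratio increases in
  \<open>s\<close> whatever the sign of \<open>\<theta>\<close>. This is the source of weak
  expansion in every fibre.\<close>

lemma logit_ratio_diff: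
  assumes "\<bar>\<theta>\<bar> \<le> 1 / 32" "0 < s" "0 < s'"
  shows "logit_ratio \<theta> s' - logit_ratio \<theta> s =
    \<theta>\<^sup>2 * (s' - s) / ((1 + (1 - \<theta>) * s') * (1 + (1 - \<theta>) * s))"
proof -
  have "0 < 1 + (1 - \<theta>) * s" "0 < 1 + (1 - \<theta>) * s'"
    using assms by (auto intro!: add_pos_pos mult_pos_pos)
  then show ?thesis unfolding logit_ratio_def
    by (simp add: divide_simps power2_eq_square) (simp add: algebra_simps)
qed

text \<open>The ratio lies between its limits \<open>1 + \<theta>\<close> as \<open>s\<close> tends
  to 0 and \<open>1 / (1 - \<theta>)\<close> as \<open>s\<close> tends to infinity.\<close>

lemma logit_ratio_bounds:
  assumes "\<bar>\<theta>\<bar> \<le> 1 / 32" "0 < s"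
  shows "31 / 32 \<le> logit_ratio \<theta> s" "logit_ratio \<theta> s \<le> 32 / 31"
proof -
  have p: "0 < 1 + (1 - \<theta>) * s"
    using assms by (auto intro!: add_pos_pos mult_pos_pos)
  have "0 \<le> (1 - 32 * \<theta>) * (31 + 32 * s)" "0 \<le> (1 + 31 * \<theta>) * s"
    using assms by (auto intro!: mult_nonneg_nonneg)
  then show "31 / 32 \<le> logit_ratio \<theta> s" "logit_ratio \<theta> s \<le> 32 / 31"
    unfolding logit_ratio_def using p assms by (auto simp: divide_simps algebra_simps)
qed

text \<open>A crude bound (\<open>ln (32 / 31)\<close> would do) that turns numbers of uncontrolled
  steps into height errors.\<close>

lemma logit_step_near:
  assumes "\<bar>\<theta>\<bar> \<le> 1 / 32"
  shows "\<bar>logit_step \<theta> x - x\<bar> \<le> 1"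
proof -
  define r where "r = logit_ratio \<theta> (exp x)"
  have r: "31 / 32 \<le> r" "r \<le> 32 / 31" using logit_ratio_bounds [OF assms, of "exp x"] by (auto simp: r_def)
  have "ln r \<le> r - 1" using r by (intro ln_le_minus_one) auto
  moreover have "ln (1 / r) \<le> 1 / r - 1" using r by (intro ln_le_minus_one) auto
  moreover have "1 / r \<le> 32 / 31" using r by (simp add: field_simps)
  moreover have "ln (1 / r) = - ln r" using r by (simp add: ln_div)
  ultimately show ?thesis using r by (simp add: logit_step_eq [OF assms] r_def [symmetric])
qed

text \<open>The ratio is at least 66/65, and \<open>ln r \<ge> 1 - 1 / r\<close> turns this into the
  gain 1/66, uniformly in \<open>x\<close>.\<close>

lemma logit_step_up:
  assumes "1 / 64 \<le> \<theta>" "\<theta> \<le> 1 / 32"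
  shows "x + 1 / 66 \<le> logit_step \<theta> x"
proof -
  have a: "\<bar>\<theta>\<bar> \<le> 1 / 32" using assms by simp
  define r where "r = logit_ratio \<theta> (exp x)"
  have r: "31 / 32 \<le> r" using logit_ratio_bounds [OF a, of "exp x"] by (auto simp: r_def)
  have p: "0 < 1 + (1 - \<theta>) * exp x"
    using assms by (auto intro!: add_pos_pos mult_pos_pos)
  have "1 + exp x \<le> 65 * \<theta> + 65 * (\<theta> * exp x) - \<theta> * exp x"
  proof -
    have "(1 + exp x) * (1 / 64) \<le> (1 + exp x) * \<theta>" using assms by (intro mult_left_mono) auto
    then show ?thesis using assms by (simp add: algebra_simps)
  qed
  moreover have "0 \<le> \<theta> * exp x" using assms by simp
  ultimately have "66 / 65 \<le> r" unfolding r_def logit_ratio_def using p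
    by (simp add: divide_simps algebra_simps)
  then have "1 / r \<le> 65 / 66" using r by (simp add: field_simps)
  moreover have "ln (1 / r) \<le> 1 / r - 1" using r by (intro ln_le_minus_one) auto
  moreover have "ln (1 / r) = - ln r" using r by (simp add: ln_div)
  ultimately show ?thesis using r by (simp add: logit_step_eq [OF a] r_def [symmetric])
qed

lemma logit_step_down:
  assumes "- (1 / 32) \<le> \<theta>" "\<theta> \<le> - (1 / 64)"
  shows "logit_step \<theta> x \<le> x - 1 / 66"
proof -
  have a: "\<bar>\<theta>\<bar> \<le> 1 / 32" using assms by simp
  define r where "r = logit_ratio \<theta> (exp x)"
  have r: "31 / 32 \<le> r" using logit_ratio_bounds [OF a, of "exp x"] by (auto simp: r_def)
  have p: "0 < 1 + (1 - \<theta>) * exp x"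
    using assms by (auto intro!: add_pos_pos mult_pos_pos)
  have "(1 + exp x) * \<theta> \<le> (1 + exp x) * (- (1 / 64))" using assms by (intro mult_left_mono) auto
  moreover have "- (1 / 32) * exp x \<le> \<theta> * exp x" using assms by (intro mult_right_mono) auto
  ultimately have "r \<le> 65 / 66" unfolding r_def logit_ratio_def using p assms
    by (simp add: divide_simps algebra_simps)
  moreover have "ln r \<le> r - 1" using r by (intro ln_le_minus_one) auto
  ultimately show ?thesis using r by (simp add: logit_step_eq [OF a] r_def [symmetric])
qed

text \<open>The displacement \<open>ln (logit_ratio \<theta> (exp x))\<close> is nondecreasing in
  \<open>x\<close>.\<close>

lemma logit_step_expands:
  assumes "\<bar>\<theta>\<bar> \<le> 1 / 32" "x \<le> y"
  shows "y - x \<le> logit_step \<theta> y - logit_step \<theta> x"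
proof -
  have "0 \<le> logit_ratio \<theta> (exp y) - logit_ratio \<theta> (exp x)"
    using assms by (auto simp: logit_ratio_diff intro!: divide_nonneg_nonneg mult_nonneg_nonneg add_nonneg_nonneg)
  moreover have "0 < logit_ratio \<theta> (exp x)" using logit_ratio_bounds [OF assms(1), of "exp x"] by simp
  ultimately show ?thesis by (simp add: logit_step_eq [OF assms(1)])
qed

text \<open>Only the initial piece from \<open>x\<close> to \<open>x + \<delta>\<close> is shown to
  gain; the rest up to \<open>y\<close> merely does not shrink. On that piece \<open>exp\<close> is
  bounded, so the ratio increases at a definite rate.\<close>

lemma logit_step_gain:
  assumes "1 / 64 \<le> \<theta>" "\<theta> \<le> 1 / 32" "0 \<le> x" "x \<le> 1" "0 \<le> \<delta>" "\<delta> \<le> 1" "x + \<delta> \<le> y"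
  shows "y - x + \<delta> / 400000 \<le> logit_step \<theta> y - logit_step \<theta> x"
proof -
  have a: "\<bar>\<theta>\<bar> \<le> 1 / 32" using assms by simp
  define s where "s = exp x"
  define s' where "s' = exp (x + \<delta>)"
  define r where "r = logit_ratio \<theta> s"
  define r' where "r' = logit_ratio \<theta> s'"
  have s1: "1 \<le> s" using assms by (simp add: s_def)
  have e3: "exp 1 \<le> (3::real)" using exp_le by simp
  have s3: "s \<le> 3" using order_trans [OF _ e3, of s] assms by (simp add: s_def)
  have ss': "s' = s * exp \<delta>" by (simp add: s_def s'_def exp_add)
  have "1 + \<delta> \<le> exp \<delta>" by (rule exp_ge_add_one_self)
  then have "s * (1 + \<delta>) \<le> s'" unfolding ss' using s1 by (intro mult_left_mono) auto
  moreover have "1 * \<delta> \<le> s * \<delta>" using s1 assms by (intro mult_right_mono) auto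
  ultimately have d: "\<delta> \<le> s' - s" by (simp add: algebra_simps)
  have "exp \<delta> \<le> 3" using order_trans [OF _ e3, of "exp \<delta>"] assms by simp
  then have s9: "s' \<le> 3 * 3" unfolding ss' using s3 s1 by (intro mult_mono) auto
  have s'1: "1 \<le> s'" using d s1 assms by linarith
  have b: "(1 - \<theta>) * s \<le> 1 * 3" "(1 - \<theta>) * s' \<le> 1 * 9"
    using assms s1 s'1 s3 s9 by (intro mult_mono; simp)+
  have "0 < 1 + (1 - \<theta>) * s" "0 < 1 + (1 - \<theta>) * s'" using assms s1 s'1
    by (auto intro!: add_pos_pos mult_pos_pos)
  then have c: "0 < (1 + (1 - \<theta>) * s') * (1 + (1 - \<theta>) * s)" "(1 + (1 - \<theta>) * s') * (1 + (1 - \<theta>) * s) \<le> 10 * 4"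
    using b by (intro mult_pos_pos mult_mono; simp)+
  have "(1 / 64)\<^sup>2 \<le> \<theta>\<^sup>2" using assms by (intro power_mono) auto
  then have "(1 / 64)\<^sup>2 * \<delta> \<le> \<theta>\<^sup>2 * (s' - s)" using d assms by (intro mult_mono) auto
  \<comment> \<open>The bounds \<open>s \<le> 3\<close> and \<open>s' \<le> 9\<close> give
    denominators at most 4 and 10, whence the constant 163840 = 64 * 64 * 40.\<close>
  then have "(1 / 64)\<^sup>2 * \<delta> / (10 * 4) \<le> \<theta>\<^sup>2 * (s' - s) / ((1 + (1 - \<theta>) * s') * (1 + (1 - \<theta>) * s))"
    using c d assms by (intro frac_le) (auto intro!: mult_nonneg_nonneg)
  also have "\<dots> = r' - r" using logit_ratio_diff [OF a, of s s'] s1 s'1 by (simp add: r_def r'_def)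
  finally have rr: "\<delta> / 163840 \<le> r' - r" by (simp add: power2_eq_square)
  have rb: "31 / 32 \<le> r" "r' \<le> 32 / 31" "0 < r'"
    using logit_ratio_bounds [OF a, of s] logit_ratio_bounds [OF a, of s'] s1 s'1
    by (auto simp: r_def r'_def)
  have "ln (r / r') \<le> r / r' - 1" using rb by (intro ln_le_minus_one) auto
  then have "1 - r / r' \<le> ln r' - ln r" using rb by (simp add: ln_div)
  \<comment> \<open>Passing to logarithms costs a division by \<open>r'\<close>, at most 32/31; the
    constant 400000 absorbs this with room to spare.\<close>
  moreover have "\<delta> / 400000 \<le> 1 - r / r'"
  proof -
    have "\<delta> / 400000 * r' \<le> \<delta> / 400000 * (32 / 31)" using rb assms by (intro mult_left_mono) auto
    also have "\<dots> \<le> \<delta> / 163840" using assms by simp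
    also have "\<dots> \<le> r' - r" by (rule rr)
    finally show ?thesis using rb by (simp add: field_simps)
  qed
  ultimately have "\<delta> + \<delta> / 400000 \<le> logit_step \<theta> (x + \<delta>) - logit_step \<theta> x"
    unfolding logit_step_eq [OF a] r_def r'_def s_def s'_def by linarith
  moreover have "y - (x + \<delta>) \<le> logit_step \<theta> y - logit_step \<theta> (x + \<delta>)"
    using assms by (intro logit_step_expands [OF a]) auto
  ultimately show ?thesis by linarith
qed

section \<open>Dependence on the parameter, and surjectivity\<close>

lemma ln_lipschitz:
  fixes a b c :: real
  assumes "0 < c" "c \<le> a" "c \<le> b"
  shows "\<bar>ln a - ln b\<bar> \<le> \<bar>a - b\<bar> / c"
proof -
  have *: "ln a - ln b \<le> \<bar>a - b\<bar> / c" if "c \<le> a" "c \<le> b" for a b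
  proof -
    have "ln (a / b) \<le> a / b - 1" using that assms by (intro ln_le_minus_one) auto
    also have "\<dots> = (a - b) / b" using that assms by (simp add: field_simps)
    also have "\<dots> \<le> \<bar>a - b\<bar> / c" using that assms by (intro frac_le) auto
    finally show ?thesis using that assms by (simp add: ln_div)
  qed
  show ?thesis using * [of a b] * [of b a] assms by (auto simp: abs_minus_commute)
qed

text \<open>Both logarithms have arguments at least \<open>31 / 32 * (1 + s)\<close>, and these
  arguments change by at most \<open>\<bar>\<theta> - \<theta>'\<bar>\<close> times 1 and
  \<open>s\<close> respectively. The factor \<open>1 + s\<close> cancels, making the bound uniform
  in \<open>x\<close>.\<close>

lemma logit_step_lipschitz:
  assumes "\<bar>\<theta>\<bar> \<le> 1 / 32" "\<bar>\<theta>'\<bar> \<le> 1 / 32"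
  shows "\<bar>logit_step \<theta> x - logit_step \<theta>' x\<bar> \<le> 2 * \<bar>\<theta> - \<theta>'\<bar>"
proof -
  define s where "s = exp x"
  have s: "0 < s" by (simp add: s_def)
  have "\<bar>ln (1 + \<theta> + s) - ln (1 + \<theta>' + s)\<bar> \<le> \<bar>(1 + \<theta> + s) - (1 + \<theta>' + s)\<bar> / (31 / 32 * (1 + s))"
    using assms s by (intro ln_lipschitz) (auto simp: algebra_simps)
  moreover have "\<bar>ln (1 + (1 - \<theta>) * s) - ln (1 + (1 - \<theta>') * s)\<bar>
      \<le> \<bar>(1 + (1 - \<theta>) * s) - (1 + (1 - \<theta>') * s)\<bar> / (31 / 32 * (1 + s))"
  proof (rule ln_lipschitz)
    have "31 / 32 * s \<le> (1 - \<theta>) * s" "31 / 32 * s \<le> (1 - \<theta>') * s"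
      using assms s by (auto intro!: mult_right_mono)
    moreover have "31 / 32 * (1 + s) = 31 / 32 + 31 / 32 * s" by (simp only: distrib_left mult_1_right)
    ultimately show "31 / 32 * (1 + s) \<le> 1 + (1 - \<theta>) * s" "31 / 32 * (1 + s) \<le> 1 + (1 - \<theta>') * s"
      by linarith+
  qed (use s in auto)
  moreover have "(1 + (1 - \<theta>) * s) - (1 + (1 - \<theta>') * s) = - ((\<theta> - \<theta>') * s)"
    by (simp add: algebra_simps)
  ultimately have "\<bar>logit_step \<theta> x - logit_step \<theta>' x\<bar> \<le>
      \<bar>\<theta> - \<theta>'\<bar> / (31 / 32 * (1 + s)) + \<bar>\<theta> - \<theta>'\<bar> * s / (31 / 32 * (1 + s))"
    using s by (simp add: logit_step_def s_def [symmetric] abs_mult)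
  also have "\<dots> = \<bar>\<theta> - \<theta>'\<bar> * (1 + s) / (31 / 32 * (1 + s))"
    by (simp add: algebra_simps add_divide_distrib)
  also have "\<dots> = 32 / 31 * \<bar>\<theta> - \<theta>'\<bar>" using s by (simp add: divide_simps)
  also have "\<dots> \<le> 2 * \<bar>\<theta> - \<theta>'\<bar>" by (intro mult_right_mono) auto
  finally show ?thesis .
qed

lemma continuous_logit_step [continuous_intros]:
  assumes "continuous_on S f" "continuous_on S h" "\<And>b. b \<in> S \<Longrightarrow> \<bar>f b\<bar> \<le> 1 / 32"
  shows "continuous_on S (\<lambda>b. logit_step (f b) (h b))"
proof -
  have "0 < 1 + f b + exp (h b)" "0 < 1 + (1 - f b) * exp (h b)" if "b \<in> S" for b
  proof -
    have b: "\<bar>f b\<bar> \<le> 1 / 32" "0 < exp (h b)" using assms(3) [OF that] by auto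
    then show "0 < 1 + f b + exp (h b)" by linarith
    show "0 < 1 + (1 - f b) * exp (h b)" using b by (intro add_pos_pos mult_pos_pos) auto
  qed
  then show ?thesis unfolding logit_step_def
    by (intro continuous_intros assms(1,2)) (force simp: less_imp_neq)+
qed

lemma logit_step_surj:
  assumes "\<bar>\<theta>\<bar> \<le> 1 / 32"
  obtains x where "logit_step \<theta> x = y"
proof -
  have "\<exists>x\<ge>y - 1. x \<le> y + 1 \<and> logit_step \<theta> x = y"
  proof (rule IVT')
    show "logit_step \<theta> (y - 1) \<le> y" "y \<le> logit_step \<theta> (y + 1)"
      using logit_step_near [OF assms, of "y - 1"] logit_step_near [OF assms, of "y + 1"] by linarith+
    show "continuous_on {y - 1..y + 1} (logit_step \<theta>)"
      using assms by (intro continuous_intros) auto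
  qed auto
  then show ?thesis using that by blast
qed

section \<open>Base orbits and their cocycle\<close>

lemma abs_torus_eq_iff: "abs_torus p = abs_torus q \<longleftrightarrow> fst p - fst q \<in> \<int> \<and> snd p - snd q \<in> \<int>"
  by (simp add: torus.abs_eq_iff torus_rel_def)

lemma continuous_abs_torus: "continuous_on UNIV abs_torus"
  by (simp add: continuous_on_open_vimage open_torus_def)

lemma continuous_on_torusI:
  assumes "continuous_on UNIV (\<lambda>p. f (abs_torus p))"
  shows "continuous_on UNIV f"
proof -
  have "open (f -` U)" if "open U" for U
    using open_vimage [OF that assms] by (simp add: open_torus_def vimage_def)
  then show ?thesis by (simp add: continuous_on_open_vimage)
qed

lemma continuous_torus_auto: "continuous_on UNIV torus_auto"
proof (rule continuous_on_torusI)
  have "continuous_on UNIV (\<lambda>p. abs_torus (3 * fst p + snd p, 2 * fst p + snd p))"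
    by (rule continuous_on_compose2 [OF continuous_abs_torus]) (auto intro!: continuous_intros)
  then show "continuous_on UNIV (\<lambda>p. torus_auto (abs_torus p))"
    by (simp add: torus_auto.abs_eq case_prod_unfold)
qed

lemma continuous_torus_cos: "continuous_on UNIV torus_cos"
proof (rule continuous_on_torusI)
  show "continuous_on UNIV (\<lambda>p. torus_cos (abs_torus p))"
    unfolding torus_cos.abs_eq case_prod_unfold by (intro continuous_intros)
qed

lemma continuous_on_skew_map: "continuous_on S skew_map"
proof -
  have "continuous_on UNIV (\<lambda>z. torus_auto (fst z))" "continuous_on UNIV (\<lambda>z. torus_cos (fst z))"
    for z :: "torus \<times> real"
    by (rule continuous_on_compose2 [OF continuous_torus_auto] continuous_on_compose2 [OF continuous_torus_cos];
        auto intro: continuous_intros)+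
  then have "continuous_on UNIV (\<lambda>z. (torus_auto (fst z), snd z + snd z * (1 - snd z) / 32 * torus_cos (fst z)))"
    by (intro continuous_intros) auto
  then show ?thesis
    unfolding skew_map_def case_prod_unfold by (rule continuous_on_subset) simp
qed

section \<open>Hyperbolic geometry of the base automorphism\<close>

text \<open>\<open>expand\<close> and \<open>contract\<close> are the eigenvalues of the matrix of
  \<open>torus_auto\<close>, which has trace 4 and determinant 1.\<close>

definition expand :: real where "expand = 2 + sqrt 3"
definition contract :: real where "contract = 2 - sqrt 3"

lemma expand_contract: "expand * contract = 1"
  by (simp add: expand_def contract_def algebra_simps)

lemma contract_bounds: "0 < contract" "contract \<le> 1 / 3"
proof -
  have "5 / 3 \<le> sqrt 3" by (rule real_le_rsqrt) (simp add: power2_eq_square)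
  moreover have "sqrt 3 < 2" by (rule real_less_lsqrt) (simp_all add: power2_eq_square)
  ultimately show "0 < contract" "contract \<le> 1 / 3" by (auto simp: contract_def)
qed

lemma contract_power_tendsto_0: "(\<lambda>n. contract ^ n * c) \<longlonglongrightarrow> 0"
  using tendsto_mult [OF LIMSEQ_realpow_zero [of contract] tendsto_const [of c]] contract_bounds by simp

lemma expand_power_contract: "j \<le> n \<Longrightarrow> expand ^ j * contract ^ n = contract ^ (n - j)"
proof -
  assume "j \<le> n"
  then have "expand ^ j * contract ^ n = (expand * contract) ^ j * contract ^ (n - j)"
    by (simp add: power_mult_distrib mult.assoc power_add [symmetric])
  then show ?thesis by (simp add: expand_contract)
qed

lemma contract_power_le_one: "contract ^ n \<le> 1"
  using contract_bounds by (intro power_le_one) auto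

text \<open>Coordinates in the eigenbasis \<open>(1, - sqrt 3 - 1)\<close> (contracted), \<open>(1, sqrt 3 - 1)\<close> (expanded),
  centred at \<open>(c, 0)\<close>.\<close>

definition eigen_point :: "real \<Rightarrow> real \<Rightarrow> real \<Rightarrow> torus" where
  "eigen_point c b a = abs_torus (c + b + a, a * (sqrt 3 - 1) - b * (sqrt 3 + 1))"

text \<open>The hypothesis makes the centre \<open>(c, 0)\<close> a fixed point on the torus; it is
  used for \<open>c = 0\<close> and \<open>c = 1 / 2\<close>.\<close>

lemma torus_auto_eigen_point:
  assumes "2 * c \<in> \<int>"
  shows "torus_auto (eigen_point c b a) = eigen_point c (contract * b) (expand * a)"
proof -
  have "sqrt 3 * (sqrt 3 * a) = 3 * a" "sqrt 3 * (sqrt 3 * b) = 3 * b"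
    by (simp_all add: mult.assoc [symmetric])
  then have eqs: "3 * (c + b + a) + (a * (sqrt 3 - 1) - b * (sqrt 3 + 1)) - (c + contract * b + expand * a) = 2 * c"
    "2 * (c + b + a) + (a * (sqrt 3 - 1) - b * (sqrt 3 + 1))
      - (expand * a * (sqrt 3 - 1) - contract * b * (sqrt 3 + 1)) = 2 * c"
    by (simp_all add: contract_def expand_def algebra_simps)
  show ?thesis using assms
    unfolding eigen_point_def torus_auto.abs_eq abs_torus_eq_iff prod.case fst_conv snd_conv eqs by simp
qed

lemma torus_auto_iterate_eigen_point:
  assumes "2 * c \<in> \<int>"
  shows "(torus_auto ^^ j) (eigen_point c b a) = eigen_point c (contract ^ j * b) (expand ^ j * a)"
  by (induction j) (simp_all add: torus_auto_eigen_point assms mult.assoc)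

lemma torus_cos_eigen_point: "torus_cos (eigen_point c b a) = cos (2 * pi * (c + b + a))"
  by (simp add: eigen_point_def torus_cos.abs_eq)

text \<open>The heteroclinic point: the unstable line of \<open>(1/2, 0)\<close> meets the stable line of \<open>(0, 0)\<close>.\<close>

definition het :: real where "het = (3 + sqrt 3) / 12"

text \<open>The first coordinates differ by the integer 1, and \<open>het\<close> is chosen so that
  the second coordinates agree exactly.\<close>

lemma heteroclinic: "eigen_point (1 / 2) b (het + a) = eigen_point 0 (het - 1 / 2 + b) a"
proof -
  have "het * (sqrt 3 - 1) + (het - 1 / 2) * (sqrt 3 + 1) = 0"
    by (simp add: het_def field_simps)
  then have "(het + a) * (sqrt 3 - 1) - b * (sqrt 3 + 1)
      - (a * (sqrt 3 - 1) - (het - 1 / 2 + b) * (sqrt 3 + 1)) = 0"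
    by (simp add: algebra_simps)
  then show ?thesis by (simp add: eigen_point_def abs_torus_eq_iff)
qed

text \<open>Powers of \<open>2 - sqrt 3\<close> are integer combinations of \<open>sqrt 3\<close>
  and 1 and tend to 0; the integer multiples of a small one form a fine grid.\<close>

lemma sqrt3_combinations_dense:
  assumes "0 < \<epsilon>"
  obtains m n :: int where "\<bar>m * sqrt 3 + n - y\<bar> < \<epsilon>"
proof -
  have *: "\<exists>(m :: int) (n :: int). contract ^ k = m * sqrt 3 + n" for k
  proof (induction k)
    case 0
    show ?case by (intro exI [of _ 0] exI [of _ 1]) simp
  next
    case (Suc k)
    then obtain m n :: int where mn: "contract ^ k = m * sqrt 3 + n" by auto
    have "contract ^ Suc k = (2 * m - n) * sqrt 3 + (2 * n - 3 * m)"
      unfolding power_Suc mn by (simp add: contract_def algebra_simps)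
    then show ?case by (intro exI [of _ "2 * m - n"] exI [of _ "2 * n - 3 * m"]) simp
  qed
  obtain k where k: "contract ^ k < \<epsilon>"
    using real_arch_pow_inv [OF assms, of contract] contract_bounds by auto
  obtain m n :: int where mn: "contract ^ k = m * sqrt 3 + n" using * by blast
  define l where "l = \<lfloor>y / contract ^ k\<rfloor>"
  have p: "0 < contract ^ k" using contract_bounds by simp
  have "of_int l \<le> y / contract ^ k" "y / contract ^ k < of_int l + 1" unfolding l_def by linarith+
  then have "of_int l * contract ^ k \<le> y" "y < of_int l * contract ^ k + contract ^ k"
    using p by (simp_all add: field_simps)
  then have "\<bar>of_int l * contract ^ k - y\<bar> < \<epsilon>" using k by linarith
  then have "\<bar>of_int (l * m) * sqrt 3 + of_int (l * n) - y\<bar> < \<epsilon>"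
    unfolding mn by (simp add: algebra_simps)
  then show ?thesis by (rule that)
qed

lemma eigen_lines_dense:
  assumes "open B" "B \<noteq> {}"
  shows "\<exists>b. eigen_point c b 0 \<in> B" "\<exists>a. eigen_point c 0 a \<in> B"
proof -
  \<comment> \<open>The sign \<open>\<sigma>\<close> selects the eigenline: slope
    \<open>sqrt 3 - 1\<close> for the unstable one, \<open>- sqrt 3 - 1\<close> for the stable
    one.\<close>
  have *: "\<exists>a. abs_torus (c + a, a * (\<sigma> * sqrt 3 - 1)) \<in> B" if \<sigma>: "\<sigma> = 1 \<or> \<sigma> = (-1 :: int)" for \<sigma>
  proof -
    obtain p where "p \<in> B" using assms(2) by blast
    then obtain x y where xy: "abs_torus (x, y) \<in> B" by (cases p rule: abs_torus_cases) auto
    have "open (abs_torus -` B)" using assms(1) by (simp add: open_torus_def)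
    moreover have "(x, y) \<in> abs_torus -` B" using xy by simp
    ultimately obtain \<epsilon> where \<epsilon>: "0 < \<epsilon>" "ball (x, y) \<epsilon> \<subseteq> abs_torus -` B"
      by (rule openE)
    define \<kappa> where "\<kappa> = \<sigma> * sqrt 3 - 1"
    obtain m n :: int where mn: "\<bar>m * sqrt 3 + n - (y - \<kappa> * (x - c))\<bar> < \<epsilon>"
      using sqrt3_combinations_dense [OF \<epsilon>(1)] by blast
    \<comment> \<open>Moving \<open>\<sigma> * m\<close> whole turns along the first coordinate
      returns to \<open>x\<close> and changes the second by \<open>m * sqrt 3\<close> modulo
      1.\<close>
    define a where "a = x - c + \<sigma> * m"
    define y' where "y' = a * \<kappa> + of_int (n + \<sigma> * m)"
    have "\<sigma> * m * \<kappa> = m * sqrt 3 - \<sigma> * m" using \<sigma> by (auto simp: \<kappa>_def algebra_simps)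
    then have "y' - y = m * sqrt 3 + n - (y - \<kappa> * (x - c))"
      by (simp add: y'_def a_def algebra_simps)
    then have "dist (x, y) (x, y') < \<epsilon>" using mn by (simp add: dist_Pair_Pair dist_real_def)
    then have "abs_torus (x, y') \<in> B" using \<epsilon> by auto
    moreover have "c + a - x = of_int (\<sigma> * m)" "a * \<kappa> - y' = of_int (- (n + \<sigma> * m))"
      by (simp_all add: a_def y'_def)
    then have "abs_torus (c + a, a * \<kappa>) = abs_torus (x, y')"
      unfolding abs_torus_eq_iff fst_conv snd_conv by (simp only: Ints_of_int simp_thms)
    ultimately show ?thesis unfolding \<kappa>_def by (intro exI [of _ a]) simp
  qed
  show "\<exists>b. eigen_point c b 0 \<in> B"
  proof -
    obtain a where "abs_torus (c + a, a * (- sqrt 3 - 1)) \<in> B" using * [of "-1"] by auto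
    moreover have "a * (- sqrt 3 - 1) = 0 * (sqrt 3 - 1) - a * (sqrt 3 + 1)" by (simp add: algebra_simps)
    ultimately show ?thesis unfolding eigen_point_def by (intro exI [of _ a]) (simp only: add_0_right)
  qed
  show "\<exists>a. eigen_point c 0 a \<in> B"
    using * [of 1] by (auto simp: eigen_point_def)
qed

lemma eigen_point_nearby:
  assumes "open B" "eigen_point c b a \<in> B"
  obtains \<eta> where "0 < \<eta>" "\<And>b' a'. \<bar>b' - b\<bar> < \<eta> \<Longrightarrow> \<bar>a' - a\<bar> < \<eta> \<Longrightarrow> eigen_point c b' a' \<in> B"
proof -
  have "continuous_on UNIV (\<lambda>p. eigen_point c (fst p) (snd p))"
    unfolding eigen_point_def
    by (rule continuous_on_compose2 [OF continuous_abs_torus]) (auto intro!: continuous_intros)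
  then have "open ((\<lambda>p. eigen_point c (fst p) (snd p)) -` B)" by (rule open_vimage [OF assms(1)])
  moreover have "(b, a) \<in> (\<lambda>p. eigen_point c (fst p) (snd p)) -` B" using assms(2) by simp
  ultimately obtain e where e: "0 < e" "ball (b, a) e \<subseteq> (\<lambda>p. eigen_point c (fst p) (snd p)) -` B"
    by (rule openE)
  show ?thesis
  proof
    show "0 < e / 2" using e by simp
    fix b' a' assume "\<bar>b' - b\<bar> < e / 2" "\<bar>a' - a\<bar> < e / 2"
    then have "\<bar>b - b'\<bar> + \<bar>a - a'\<bar> < e" by linarith
    then have "dist (b, a) (b', a') < e"
      using sqrt_sum_squares_le_sum_abs [of "b - b'" "a - a'"] by (simp add: dist_Pair_Pair dist_real_def)
    then show "eigen_point c b' a' \<in> B" using e by auto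
  qed
qed

section \<open>The fibre cocycle over a base orbit\<close>

definition angle :: "torus \<Rightarrow> nat \<Rightarrow> real" where
  "angle b j = torus_cos ((torus_auto ^^ j) b) / 32"

primrec height :: "torus \<Rightarrow> nat \<Rightarrow> real \<Rightarrow> real" where
  "height b 0 x = x"
| "height b (Suc j) x = logit_step (angle b j) (height b j x)"

lemma angle_bound: "\<bar>angle b j\<bar> \<le> 1 / 32"
  by (simp only: angle_def torus_cos_bound)

lemma skew_map_iterate:
  "(skew_map ^^ j) (b, logistic x) = ((torus_auto ^^ j) b, logistic (height b j x))"
  by (induction j) (simp_all add: skew_map_alt logistic_logit_step [OF angle_bound], simp add: angle_def)

lemma height_gap_mono:
  assumes "x \<le> y" "i \<le> j"
  shows "height b i y - height b i x \<le> height b j y - height b j x"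
proof -
  \<comment> \<open>Order is carried along in the induction because the expansion estimate applies
    to ordered pairs.\<close>
  have step: "height b j x \<le> height b j y \<and> height b j y - height b j x \<le> height b (Suc j) y - height b (Suc j) x"
    if "x \<le> y" for j
  proof (induction j)
    case 0
    then show ?case using that logit_step_expands [OF angle_bound, of x y] by simp
  next
    case (Suc j)
    then have "height b (Suc j) x \<le> height b (Suc j) y" by linarith
    then show ?case using logit_step_expands [OF angle_bound] by simp
  qed
  show ?thesis using lift_Suc_mono_le [OF _ assms(2), of "\<lambda>j. height b j y - height b j x"] step [OF assms(1)] by blast
qed

lemma height_less_iff: "height b j x < height b j y \<longleftrightarrow> x < y"
  using height_gap_mono [of x y 0 j b] height_gap_mono [of y x 0 j b] by (cases x y rule: linorder_cases) auto

lemma height_surj: "\<exists>x. height b j x = s"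
proof (induction j arbitrary: s)
  case (Suc j)
  obtain y where "logit_step (angle b j) y = s" using logit_step_surj [OF angle_bound] by blast
  moreover obtain x where "height b j x = y" using Suc by blast
  ultimately show ?case by (intro exI [of _ x]) simp
qed simp

lemma continuous_torus_auto_iterate: "continuous_on UNIV (torus_auto ^^ j)"
proof (induction j)
  case (Suc j)
  then show ?case
    using continuous_on_compose2 [OF continuous_torus_auto Suc] by (simp add: o_def)
qed (simp add: id_def)

lemma continuous_height: "continuous_on UNIV (\<lambda>b. height b j x)"
proof (induction j)
  case (Suc j)
  have "continuous_on UNIV (\<lambda>b. angle b j)" unfolding angle_def
    using continuous_on_compose2 [OF continuous_torus_cos continuous_torus_auto_iterate]
    by (intro continuous_intros) auto
  then show ?case using Suc angle_bound by (simp add: continuous_logit_step)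
qed simp

lemma height_near: "i \<le> j \<Longrightarrow> \<bar>height b j x - height b i x\<bar> \<le> real j - real i"
proof (induction j rule: dec_induct)
  case (step j)
  then show ?case using logit_step_near [OF angle_bound, of b j "height b j x"] by simp
qed simp

lemma height_up:
  assumes "i \<le> j" "\<And>l. i \<le> l \<Longrightarrow> l < j \<Longrightarrow> 1 / 64 \<le> angle b l"
  shows "height b i x + (real j - real i) / 66 \<le> height b j x"
  using assms
proof (induction j rule: dec_induct)
  case (step j)
  have "1 / 64 \<le> angle b j" "angle b j \<le> 1 / 32" using step angle_bound [of b j] by auto
  from logit_step_up [OF this, of "height b j x"] show ?case using step by (simp add: field_simps)
qed simp

lemma height_down:
  assumes "i \<le> j" "\<And>l. i \<le> l \<Longrightarrow> l < j \<Longrightarrow> angle b l \<le> - (1 / 64)"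
  shows "height b j x \<le> height b i x - (real j - real i) / 66"
  using assms
proof (induction j rule: dec_induct)
  case (step j)
  have "- (1 / 32) \<le> angle b j" "angle b j \<le> - (1 / 64)" using step angle_bound [of b j] by auto
  from logit_step_down [OF this, of "height b j x"] show ?case using step by (simp add: field_simps)
qed simp

text \<open>Expansion read backwards is contraction, so errors are never amplified; each step adds
  only the effect of the differing parameters.\<close>

lemma height_backward:
  assumes "i \<le> j"
  shows "\<bar>height b i x - height b' i x'\<bar>
    \<le> \<bar>height b j x - height b' j x'\<bar> + (\<Sum>l=i..<j. 2 * \<bar>angle b l - angle b' l\<bar>)"
  using assms
proof (induction j rule: dec_induct)
  case (step j)
  define u where "u = height b j x"
  define v where "v = height b' j x'"
  have "\<bar>u - v\<bar> \<le> \<bar>logit_step (angle b j) u - logit_step (angle b j) v\<bar>"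
    using logit_step_expands [OF angle_bound, of u v b j] logit_step_expands [OF angle_bound, of v u b j]
    by (cases "u \<le> v") auto
  also have "\<dots> \<le> \<bar>logit_step (angle b j) u - logit_step (angle b' j) v\<bar> + 2 * \<bar>angle b j - angle b' j\<bar>"
    using logit_step_lipschitz [of "angle b j" "angle b' j" v, OF angle_bound angle_bound] by linarith
  finally show ?case using step by (simp add: u_def v_def)
qed simp

section \<open>Heteroclinic itineraries\<close>

lemma cos_ge_half:
  assumes "\<bar>x\<bar> \<le> 1 / 6"
  shows "1 / 2 \<le> cos (2 * pi * x)"
proof -
  have "cos (pi / 3) \<le> cos (2 * pi * \<bar>x\<bar>)"
    using assms by (intro cos_monotone_0_pi_le) (auto simp: field_simps)
  moreover have "cos (2 * pi * \<bar>x\<bar>) = cos (2 * pi * x)" by (cases "0 \<le> x") auto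
  ultimately show ?thesis by (simp add: cos_60)
qed

text \<open>The orbit of this point starts near \<open>eigen_point (1 / 2) s 0\<close>, stays close to \<open>(1/2, 0)\<close> until about time
  \<open>n\<close>, follows the heteroclinic connection to \<open>(0, 0)\<close>, leaves after \<open>k\<close> further steps and arrives
  near \<open>eigen_point 0 0 w\<close> at time \<open>n + k\<close>.\<close>

definition itinerary :: "real \<Rightarrow> real \<Rightarrow> nat \<Rightarrow> nat \<Rightarrow> torus" where
  "itinerary s w n k = eigen_point (1 / 2) s (contract ^ n * het + contract ^ (n + k) * w)"

lemma itinerary_iterate:
  "(torus_auto ^^ j) (itinerary s w n k) = eigen_point (1 / 2) (contract ^ j * s)
     (expand ^ j * (contract ^ n * het + contract ^ (n + k) * w))"
  unfolding itinerary_def by (rule torus_auto_iterate_eigen_point) simp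

lemma itinerary_iterate_late:
  assumes "i \<le> k"
  shows "(torus_auto ^^ (n + i)) (itinerary s w n k) =
    eigen_point 0 (contract ^ i * (het - 1 / 2 + contract ^ n * s)) (contract ^ (k - i) * w)"
proof -
  \<comment> \<open>At time \<open>n\<close> the unstable coordinate about \<open>(1/2, 0)\<close>
    is \<open>het\<close> plus a correction, so \<open>heteroclinic\<close> recentres the point at
    \<open>(0, 0)\<close>.\<close>
  have "(torus_auto ^^ n) (itinerary s w n k) = eigen_point (1 / 2) (contract ^ n * s) (het + contract ^ k * w)"
    unfolding itinerary_iterate
    using expand_power_contract [of n n] expand_power_contract [of n "n + k"]
    by (simp add: distrib_left mult.assoc [symmetric])
  also have "\<dots> = eigen_point 0 (het - 1 / 2 + contract ^ n * s) (contract ^ k * w)" by (rule heteroclinic)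
  finally have "(torus_auto ^^ (n + i)) (itinerary s w n k) =
      (torus_auto ^^ i) (eigen_point 0 (het - 1 / 2 + contract ^ n * s) (contract ^ k * w))"
    by (simp add: funpow_add add.commute [of n])
  also have "\<dots> = eigen_point 0 (contract ^ i * (het - 1 / 2 + contract ^ n * s)) (contract ^ (k - i) * w)"
    using assms by (simp add: torus_auto_iterate_eigen_point mult.assoc [symmetric] expand_power_contract)
  finally show ?thesis .
qed

text \<open>The number \<open>J\<close> of uncontrolled steps at each end of a phase is independent
  of \<open>n\<close> and \<open>k\<close>, so long phases dominate. In the controlled range the
  offset from the centre is a sum of three terms, each at most 1/18.\<close>

lemma itinerary_angles:
  obtains J where
    "\<And>n k j. J \<le> j \<Longrightarrow> j + J \<le> n \<Longrightarrow> angle (itinerary s w n k) j \<le> - (1 / 64)"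
    "\<And>n k i. J \<le> i \<Longrightarrow> i + J \<le> k \<Longrightarrow> 1 / 64 \<le> angle (itinerary s w n k) (n + i)"
proof -
  define K where "K = \<bar>s\<bar> + \<bar>w\<bar> + \<bar>het\<bar> + \<bar>het - 1 / 2\<bar>"
  have "eventually (\<lambda>J. contract ^ J * K < 1 / 18) sequentially"
    using order_tendstoD(2) [OF contract_power_tendsto_0 [of K], of "1 / 18"] by simp
  then obtain J where J: "contract ^ J * K < 1 / 18" by (auto simp: eventually_sequentially)
  have small: "\<bar>contract ^ j * c\<bar> \<le> 1 / 18" if "J \<le> j" "\<bar>c\<bar> \<le> K" for j c
  proof -
    have "\<bar>contract ^ j * c\<bar> = contract ^ j * \<bar>c\<bar>" using contract_bounds by (simp add: abs_mult)
    also have "\<dots> \<le> contract ^ J * K"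
      using that contract_bounds by (intro mult_mono power_decreasing) auto
    finally show ?thesis using J by simp
  qed
  have Kb: "\<bar>s\<bar> \<le> K" "\<bar>w\<bar> \<le> K" "\<bar>het\<bar> \<le> K" "\<bar>het - 1 / 2\<bar> \<le> K"
    unfolding K_def by linarith+
  show ?thesis
  proof
    fix n k j assume j: "J \<le> j" "j + J \<le> n"
    have "expand ^ j * (contract ^ n * het + contract ^ (n + k) * w) =
        contract ^ (n - j) * het + contract ^ (n + k - j) * w"
      using expand_power_contract [of j n] expand_power_contract [of j "n + k"] j
      by (simp add: distrib_left mult.assoc [symmetric])
    moreover have "\<bar>contract ^ j * s\<bar> \<le> 1 / 18" "\<bar>contract ^ (n - j) * het\<bar> \<le> 1 / 18"
      "\<bar>contract ^ (n + k - j) * w\<bar> \<le> 1 / 18"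
      using j Kb by (intro small; simp)+
    ultimately have x: "\<bar>contract ^ j * s + expand ^ j * (contract ^ n * het + contract ^ (n + k) * w)\<bar> \<le> 1 / 6"
      (is "\<bar>?x\<bar> \<le> _") by linarith
    have "angle (itinerary s w n k) j = cos (pi + 2 * pi * ?x) / 32"
      by (simp add: angle_def itinerary_iterate torus_cos_eigen_point algebra_simps)
    then show "angle (itinerary s w n k) j \<le> - (1 / 64)" using cos_ge_half [OF x] by simp
  next
    fix n k i assume i: "J \<le> i" "i + J \<le> k"
    have "\<bar>contract ^ i * (het - 1 / 2)\<bar> \<le> 1 / 18" "\<bar>contract ^ (n + i) * s\<bar> \<le> 1 / 18"
      "\<bar>contract ^ (k - i) * w\<bar> \<le> 1 / 18"
      using i Kb by (intro small; simp)+
    moreover have "contract ^ i * (het - 1 / 2 + contract ^ n * s) =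
        contract ^ i * (het - 1 / 2) + contract ^ (n + i) * s"
      by (simp add: distrib_left power_add)
    ultimately have x: "\<bar>contract ^ i * (het - 1 / 2 + contract ^ n * s) + contract ^ (k - i) * w\<bar> \<le> 1 / 6"
      by linarith
    show "1 / 64 \<le> angle (itinerary s w n k) (n + i)"
      using cos_ge_half [OF x] i by (simp add: angle_def itinerary_iterate_late torus_cos_eigen_point)
  qed
qed

section \<open>Transitivity\<close>

lemma open_torus_less: "open {b. height b j x < c}" "open {b. c < height b j x}"
  by (simp_all add: open_Collect_less continuous_height)

lemma eventually_real_gt: "eventually (\<lambda>n. c < real n) sequentially"
  using filterlim_real_sequentially by (simp add: filterlim_at_top_dense)

section \<open>Unbounded growth of fibre gaps\<close>

text \<open>An orbit staying long near \<open>(1/2, 0)\<close> and then converging to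
  \<open>(0, 0)\<close> brings the lower height below 0 and lifts it again. Steps have size at most
  1, so it lands between 0 and 1 on crossing, where \<open>logit_step_gain\<close> applies.\<close>

lemma gap_gain:
  assumes "open B" "B \<noteq> {}" "lo < hi"
  shows "\<exists>b\<in>B. \<exists>j\<ge>m. height b m hi - height b m lo + min 1 (hi - lo) / 400000
    \<le> height b (Suc j) hi - height b (Suc j) lo"
proof -
  obtain s where s: "eigen_point (1 / 2) s 0 \<in> B" using eigen_lines_dense(1) [OF assms(1,2)] by blast
  obtain \<eta> where \<eta>: "0 < \<eta>" "\<And>b' a'. \<bar>b' - s\<bar> < \<eta> \<Longrightarrow> \<bar>a' - 0\<bar> < \<eta> \<Longrightarrow> eigen_point (1 / 2) b' a' \<in> B"
    using eigen_point_nearby [OF assms(1) s] by blast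
  obtain J where J:
    "\<And>n k j. J \<le> j \<Longrightarrow> j + J \<le> n \<Longrightarrow> angle (itinerary s 0 n k) j \<le> - (1 / 64)"
    "\<And>n k i. J \<le> i \<Longrightarrow> i + J \<le> k \<Longrightarrow> 1 / 64 \<le> angle (itinerary s 0 n k) (n + i)"
    using itinerary_angles [of s 0] by blast
  have "eventually (\<lambda>n. \<bar>contract ^ n * het\<bar> < \<eta>) sequentially"
    using order_tendstoD(2) [OF tendsto_rabs [OF contract_power_tendsto_0 [of het]], of \<eta>] \<eta> by simp
  \<comment> \<open>The \<open>3 * J\<close> bounds the drift over the first \<open>J\<close> steps
    and the \<open>2 * J\<close> steps around time \<open>n\<close>; the other
    \<open>n - 2 * J\<close> steps all descend.\<close>
  moreover have "eventually (\<lambda>n. lo + 3 * J - (real n - 2 * J) / 66 < 0) sequentially"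
    using eventually_real_gt [of "66 * (lo + 3 * J) + 2 * J"] by eventually_elim (simp add: field_simps)
  moreover have "eventually (\<lambda>n. m + 2 * J \<le> n) sequentially" by (rule eventually_ge_at_top)
  ultimately have "eventually (\<lambda>n. \<bar>contract ^ n * het\<bar> < \<eta> \<and> lo + 3 * J - (real n - 2 * J) / 66 < 0 \<and> m + 2 * J \<le> n) sequentially"
    by eventually_elim auto
  then obtain n where n: "\<bar>contract ^ n * het\<bar> < \<eta>" "lo + 3 * J - (real n - 2 * J) / 66 < 0" "m + 2 * J \<le> n"
    by (auto simp: eventually_sequentially)
  define b where "b = itinerary s 0 n 0"
  \<comment> \<open>With \<open>w = 0\<close> the point lies on the stable line of
    \<open>(0, 0)\<close> and does not depend on \<open>k\<close>, so the upward estimate holds at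
    all late times.\<close>
  have b_eq: "b = itinerary s 0 n k" for k by (simp add: b_def itinerary_def)
  have bB: "b \<in> B" unfolding b_def itinerary_def using n \<eta> by (intro \<eta>(2)) auto
  have up: "1 / 64 \<le> angle b l" if "n + J \<le> l" for l
    using J(2) [of "l - n" "l - n + J" n] that by (simp add: b_eq [of "l - n + J"])
  have down: "angle b l \<le> - (1 / 64)" if "J \<le> l" "l < n - J" for l
    unfolding b_def using that by (intro J(1)) auto
  define h where "h i = height b (n + J + i) lo" for i
  have "height b J lo \<le> lo + J" using height_near [of 0 J b lo] by simp
  moreover have "height b (n - J) lo \<le> height b J lo - (real (n - J) - J) / 66"
    using n down by (intro height_down) auto
  moreover have "height b (n + J) lo \<le> height b (n - J) lo + (real (n + J) - real (n - J))"
    using height_near [of "n - J" "n + J" b lo] diff_le_self [of n J] by linarith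
  moreover have nJ: "real (n - J) = real n - real J" using n by simp
  ultimately have h0: "h 0 < 0"
    using n(2) unfolding h_def add_0_right of_nat_mult of_nat_add of_nat_numeral nJ by argo
  have "h 0 + (real (n + J + i) - real (n + J)) / 66 \<le> h i" for i
    unfolding h_def using height_up [of "n + J" "n + J + i" b lo] up by simp
  then have grow: "h 0 + real i / 66 \<le> h i" for i by simp
  obtain i where "- (66 * h 0) \<le> real i" using real_arch_simple by blast
  then have "0 \<le> h i" using grow [of i] by linarith
  \<comment> \<open>The first crossing of 0; since \<open>h 0 < 0\<close> it has a predecessor,
    still below 0.\<close>
  then obtain i where i: "0 \<le> h i" "\<And>i'. i' < i \<Longrightarrow> h i' < 0"
    using exists_least_iff [of "\<lambda>i. 0 \<le> h i"] by (auto simp: not_le)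
  then obtain i' where i': "i = Suc i'" using h0 by (cases i) auto
  have hi1: "h i \<le> 1"
    using i(2) [of i'] height_near [of "n + J + i'" "n + J + i" b lo] by (simp add: h_def i')
  define j where "j = n + J + i"
  have ang: "1 / 64 \<le> angle b j" "angle b j \<le> 1 / 32"
    using up [of j] angle_bound [of b j] by (auto simp: j_def)
  have gap: "hi - lo \<le> height b j hi - height b j lo" "height b m hi - height b m lo \<le> height b j hi - height b j lo"
    using height_gap_mono [of lo hi 0 j b] height_gap_mono [of lo hi m j b] assms n by (auto simp: j_def)
  have "height b j hi - height b j lo + min 1 (hi - lo) / 400000
    \<le> height b (Suc j) hi - height b (Suc j) lo"
    unfolding height.simps using ang i(1) hi1 gap assms
    by (intro logit_step_gain) (auto simp: h_def j_def)
  with gap n bB show ?thesis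
    by (intro bexI [of _ b] exI [of _ j]) (auto simp: j_def)
qed

lemma gap_unbounded:
  assumes "open B" "B \<noteq> {}" "lo < hi"
  shows "\<exists>b\<in>B. \<exists>j. D < height b j hi - height b j lo"
proof -
  define \<epsilon> where "\<epsilon> = min 1 (hi - lo) / 800000"
  have \<epsilon>: "0 < \<epsilon>" "min 1 (hi - lo) / 400000 = 2 * \<epsilon>" using assms by (auto simp: \<epsilon>_def)
  have *: "\<exists>b\<in>B. \<exists>j. real N * \<epsilon> < height b j hi - height b j lo" for N
  proof (induction N)
    case 0
    obtain b where "b \<in> B" using assms by blast
    then show ?case using assms(3) by (intro bexI [of _ b] exI [of _ 0]) auto
  next
    case (Suc N)
    then obtain b j where b: "b \<in> B" "real N * \<epsilon> < height b j hi - height b j lo" by blast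
    \<comment> \<open>The gap already won is an open condition on the base point, so
      \<open>gap_gain\<close> can be applied inside this set from time \<open>j\<close> on, adding a
      fixed amount.\<close>
    let ?B = "B \<inter> {b. real N * \<epsilon> < height b j hi - height b j lo}"
    have "open ?B" using assms(1)
      by (intro open_Int open_Collect_less continuous_intros continuous_height)
    from gap_gain [OF this _ assms(3), of j] b obtain b' i where
      b': "b' \<in> ?B" "height b' j hi - height b' j lo + 2 * \<epsilon> \<le> height b' (Suc i) hi - height b' (Suc i) lo"
      unfolding \<epsilon>(2) by blast
    then have "real (Suc N) * \<epsilon> < height b' (Suc i) hi - height b' (Suc i) lo"
      using \<epsilon>(1) by (simp add: algebra_simps)
    then show ?case using b' by blast
  qed
  obtain N where "D / \<epsilon> \<le> real N" using real_arch_simple by blast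
  then have "D \<le> real N * \<epsilon>" using \<epsilon>(1) by (simp add: field_simps)
  then show ?thesis using * [of N] by (meson le_less_trans)
qed

section \<open>Pulling a target height back\<close>

lemma contract_power_sum: "(\<Sum>l=m..<M. contract ^ (M - l)) \<le> 1"
proof -
  have "(\<Sum>l<M. contract ^ (M - l)) \<le> 1"
  proof (induction M)
    case (Suc M)
    have "(\<Sum>l<Suc M. contract ^ (Suc M - l)) = contract * ((\<Sum>l<M. contract ^ (M - l)) + 1)"
      by (simp add: sum_distrib_left distrib_left Suc_diff_le)
    also have "\<dots> \<le> contract * (1 + 1)" using Suc contract_bounds by (intro mult_left_mono) auto
    finally show ?case using contract_bounds by simp
  qed simp
  moreover have "(\<Sum>l=m..<M. contract ^ (M - l)) \<le> (\<Sum>l<M. contract ^ (M - l))"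
    using contract_bounds by (intro sum_mono2) auto
  ultimately show ?thesis by simp
qed

lemma abs_cos_diff_le: "\<bar>cos x - cos y\<bar> \<le> \<bar>x - y\<bar>" for x y :: real
proof -
  have "\<bar>cos x - cos y\<bar> = 2 * \<bar>sin ((x + y) / 2)\<bar> * \<bar>sin ((y - x) / 2)\<bar>"
    by (simp add: cos_diff_cos abs_mult)
  also have "\<dots> \<le> 2 * 1 * \<bar>(y - x) / 2\<bar>"
    by (intro mult_mono abs_sin_le_one abs_sin_x_le_abs_x) auto
  finally show ?thesis by simp
qed

text \<open>The two orbits share their stable coordinate; the unstable ones differ by a multiple of
  \<open>w\<close> that shrinks geometrically backwards from time \<open>n + k\<close>.\<close>

lemma itinerary_angle_diff:
  assumes "l \<le> n + k"
  shows "2 * \<bar>angle (itinerary s w n k) l - angle (itinerary s w n (Suc k)) l\<bar> \<le> \<bar>w\<bar> * contract ^ (n + k - l)"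
proof -
  let ?p = "\<lambda>k. contract ^ l * s + expand ^ l * (contract ^ n * het + contract ^ (n + k) * w)"
  have e: "expand ^ l * contract ^ (n + k) = contract ^ (n + k - l)"
    using assms by (rule expand_power_contract)
  have "?p k - ?p (Suc k) = expand ^ l * contract ^ (n + k) * ((1 - contract) * w)"
    by (simp add: algebra_simps)
  then have d: "\<bar>?p k - ?p (Suc k)\<bar> = contract ^ (n + k - l) * ((1 - contract) * \<bar>w\<bar>)"
    using contract_bounds unfolding e by (simp add: abs_mult)
  have "2 * pi * (1 / 2 + contract ^ l * s + expand ^ l * (contract ^ n * het + contract ^ (n + k) * w)) -
      2 * pi * (1 / 2 + contract ^ l * s + expand ^ l * (contract ^ n * het + contract ^ (n + Suc k) * w))
    = 2 * pi * (?p k - ?p (Suc k))"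
    by (simp add: algebra_simps)
  then have "\<bar>cos (2 * pi * (1 / 2 + contract ^ l * s + expand ^ l * (contract ^ n * het + contract ^ (n + k) * w))) -
      cos (2 * pi * (1 / 2 + contract ^ l * s + expand ^ l * (contract ^ n * het + contract ^ (n + Suc k) * w)))\<bar>
    \<le> \<bar>2 * pi * (?p k - ?p (Suc k))\<bar>"
    using abs_cos_diff_le by metis
  then have "\<bar>angle (itinerary s w n k) l - angle (itinerary s w n (Suc k)) l\<bar>
      \<le> \<bar>2 * pi * (?p k - ?p (Suc k))\<bar> / 32"
    unfolding angle_def itinerary_iterate torus_cos_eigen_point diff_divide_distrib [symmetric] abs_divide
    by simp
  also have "\<dots> = 2 * pi * (contract ^ (n + k - l) * ((1 - contract) * \<bar>w\<bar>)) / 32"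
    unfolding abs_mult d by simp
  also have "\<dots> \<le> 2 * 4 * (contract ^ (n + k - l) * (1 * \<bar>w\<bar>)) / 32"
    using pi_less_4 contract_bounds by (intro divide_right_mono mult_mono) auto
  also have "\<dots> \<le> \<bar>w\<bar> * contract ^ (n + k - l) / 2"
    using contract_bounds by (simp add: mult.commute)
  finally show ?thesis by simp
qed

text \<open>At time \<open>n + k\<close> the heights differ by at most one step, since the second
  orbit reaches \<open>y\<close> one step later. Pulling back adds a geometric series bounded by
  \<open>\<bar>w\<bar>\<close>, so the bound does not depend on \<open>n\<close>, \<open>k\<close>,
  \<open>m\<close> or \<open>y\<close>.\<close>

lemma backward_height_step:
  assumes "m \<le> n + k" "height (itinerary s w n k) (n + k) x = y" "height (itinerary s w n (Suc k)) (n + Suc k) x' = y"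
  shows "\<bar>height (itinerary s w n k) m x - height (itinerary s w n (Suc k)) m x'\<bar> \<le> 1 + \<bar>w\<bar>"
proof -
  let ?b = "itinerary s w n k" and ?b' = "itinerary s w n (Suc k)"
  have "\<bar>height ?b m x - height ?b' m x'\<bar> \<le> \<bar>height ?b (n + k) x - height ?b' (n + k) x'\<bar>
      + (\<Sum>l=m..<n + k. 2 * \<bar>angle ?b l - angle ?b' l\<bar>)"
    by (rule height_backward [OF assms(1)])
  also have "\<bar>height ?b (n + k) x - height ?b' (n + k) x'\<bar> \<le> 1"
    using height_near [of "n + k" "n + Suc k" ?b' x'] assms by simp
  also have "(\<Sum>l=m..<n + k. 2 * \<bar>angle ?b l - angle ?b' l\<bar>) \<le> (\<Sum>l=m..<n + k. \<bar>w\<bar> * contract ^ (n + k - l))"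
    by (intro sum_mono itinerary_angle_diff) auto
  also have "\<dots> \<le> \<bar>w\<bar> * 1"
    unfolding sum_distrib_left [symmetric] by (intro mult_left_mono contract_power_sum) auto
  finally show ?thesis by simp
qed

text \<open>A discrete intermediate value argument in \<open>k\<close>: the pulled-back height
  \<open>S k\<close> starts above a window, ends below its upper end, and moves by no more than the
  window length at each step.\<close>

lemma target_height_reached:
  assumes B: "open B" "B \<noteq> {}" and lohi: "lo < hi" and C: "open C" "C \<noteq> {}"
  shows "\<exists>b\<in>B. \<exists>x. \<exists>j>0. lo < x \<and> x < hi \<and> (torus_auto ^^ j) b \<in> C \<and> height b j x = y"
proof -
  obtain w where w: "eigen_point 0 0 w \<in> C" using eigen_lines_dense(2) [OF C] by blast
  obtain \<eta> where \<eta>: "0 < \<eta>" "\<And>b' a'. \<bar>b' - 0\<bar> < \<eta> \<Longrightarrow> \<bar>a' - w\<bar> < \<eta> \<Longrightarrow> eigen_point 0 b' a' \<in> C"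
    using eigen_point_nearby [OF C(1) w] by blast
  obtain b0 m where b0: "b0 \<in> B" "1 + \<bar>w\<bar> < height b0 m hi - height b0 m lo"
    using gap_unbounded [OF B lohi] by blast
  \<comment> \<open>Half the surplus gap, so that the window from \<open>u\<close> to
    \<open>v\<close> has length exactly \<open>1 + \<bar>w\<bar>\<close> with strict margins on both
    sides.\<close>
  define \<zeta> where "\<zeta> = (height b0 m hi - height b0 m lo - (1 + \<bar>w\<bar>)) / 2"
  define u where "u = height b0 m lo + \<zeta>"
  define v where "v = height b0 m hi - \<zeta>"
  have uv: "height b0 m lo < u" "v < height b0 m hi" "v - u = 1 + \<bar>w\<bar>"
    using b0 by (auto simp: u_def v_def \<zeta>_def field_simps)
  \<comment> \<open>The margins make the window valid on an open set of base points, which will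
    contain all the itineraries used.\<close>
  define B0 where "B0 = B \<inter> {b. height b m lo < u} \<inter> {b. v < height b m hi}"
  have "open B0" unfolding B0_def by (intro open_Int B open_torus_less)
  moreover have "b0 \<in> B0" using uv b0 by (simp add: B0_def)
  ultimately obtain s where s: "eigen_point (1 / 2) s 0 \<in> B0" using eigen_lines_dense(1) by blast
  obtain \<theta> where \<theta>: "0 < \<theta>" "\<And>b' a'. \<bar>b' - s\<bar> < \<theta> \<Longrightarrow> \<bar>a' - 0\<bar> < \<theta> \<Longrightarrow> eigen_point (1 / 2) b' a' \<in> B0"
    using eigen_point_nearby [OF \<open>open B0\<close> s] by blast
  obtain J where J:
    "\<And>n k j. J \<le> j \<Longrightarrow> j + J \<le> n \<Longrightarrow> angle (itinerary s w n k) j \<le> - (1 / 64)"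
    "\<And>n k i. J \<le> i \<Longrightarrow> i + J \<le> k \<Longrightarrow> 1 / 64 \<le> angle (itinerary s w n k) (n + i)"
    using itinerary_angles [of s w] by blast
  have "eventually (\<lambda>k. contract ^ k * \<bar>het - 1 / 2\<bar> < \<eta> / 2) sequentially"
    using order_tendstoD(2) [OF contract_power_tendsto_0, of "\<eta> / 2"] \<eta> by simp
  then obtain k0 where k0: "\<And>k. k0 \<le> k \<Longrightarrow> contract ^ k * \<bar>het - 1 / 2\<bar> < \<eta> / 2"
    by (auto simp: eventually_sequentially)
  have "eventually (\<lambda>n. contract ^ n * \<bar>s\<bar> < \<eta> / 2) sequentially"
    using order_tendstoD(2) [OF contract_power_tendsto_0, of "\<eta> / 2"] \<eta> by simp
  moreover have "eventually (\<lambda>n. contract ^ n * (\<bar>het\<bar> + \<bar>w\<bar>) < \<theta>) sequentially"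
    using order_tendstoD(2) [OF contract_power_tendsto_0] \<theta> by simp
  \<comment> \<open>For \<open>k = k0\<close> the uncontrolled steps are the first \<open>J\<close>
    after time \<open>m\<close> and the last \<open>J + k0\<close>; the descent in between forces a
    high starting height.\<close>
  moreover have "eventually (\<lambda>n. v < y - 2 * J - k0 + (real n - 2 * J - m) / 66) sequentially"
    using eventually_real_gt [of "66 * (v - y + 2 * J + k0) + 2 * J + m"]
    by eventually_elim (simp add: field_simps)
  \<comment> \<open>The summand 1 makes \<open>n\<close>, and hence the number of iterations,
    positive.\<close>
  moreover have "eventually (\<lambda>n. 1 + m + 2 * J \<le> n) sequentially" by (rule eventually_ge_at_top)
  ultimately have "eventually (\<lambda>n. contract ^ n * \<bar>s\<bar> < \<eta> / 2 \<and> contract ^ n * (\<bar>het\<bar> + \<bar>w\<bar>) < \<theta> \<and>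
      v < y - 2 * J - k0 + (real n - 2 * J - m) / 66 \<and> 1 + m + 2 * J \<le> n) sequentially"
    by eventually_elim auto
  then obtain n where n: "contract ^ n * \<bar>s\<bar> < \<eta> / 2" "contract ^ n * (\<bar>het\<bar> + \<bar>w\<bar>) < \<theta>"
    "v < y - 2 * J - k0 + (real n - 2 * J - m) / 66" "1 + m + 2 * J \<le> n"
    by (auto simp: eventually_sequentially)
  define b where "b k = itinerary s w n k" for k
  have bB: "b k \<in> B0" for k
  proof -
    have "\<bar>contract ^ n * het + contract ^ (n + k) * w\<bar> \<le> \<bar>contract ^ n * het\<bar> + \<bar>contract ^ (n + k) * w\<bar>"
      by (rule abs_triangle_ineq)
    also have "\<dots> = contract ^ n * \<bar>het\<bar> + contract ^ n * (contract ^ k * \<bar>w\<bar>)"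
      using contract_bounds by (simp add: abs_mult power_add)
    also have "\<dots> \<le> contract ^ n * \<bar>het\<bar> + contract ^ n * (1 * \<bar>w\<bar>)"
      using contract_bounds contract_power_le_one [of k]
      by (intro add_left_mono mult_left_mono mult_right_mono) auto
    also have "\<dots> < \<theta>" using n(2) by (simp add: distrib_left)
    finally show ?thesis unfolding b_def itinerary_def using \<theta> by (intro \<theta>(2)) auto
  qed
  have bC: "(torus_auto ^^ (n + k)) (b k) \<in> C" if "k0 \<le> k" for k
  proof -
    have "\<bar>contract ^ k * (het - 1 / 2 + contract ^ n * s)\<bar>
        = contract ^ k * \<bar>het - 1 / 2 + contract ^ n * s\<bar>"
      using contract_bounds by (simp add: abs_mult)
    also have "\<dots> \<le> contract ^ k * (\<bar>het - 1 / 2\<bar> + \<bar>contract ^ n * s\<bar>)"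
      using contract_bounds by (intro mult_left_mono) auto
    also have "\<dots> = contract ^ k * \<bar>het - 1 / 2\<bar> + contract ^ k * (contract ^ n * \<bar>s\<bar>)"
      using contract_bounds by (simp add: distrib_left abs_mult)
    also have "\<dots> \<le> contract ^ k * \<bar>het - 1 / 2\<bar> + 1 * (contract ^ n * \<bar>s\<bar>)"
      using contract_bounds contract_power_le_one [of k]
      by (intro add_left_mono mult_right_mono) auto
    also have "\<dots> < \<eta>" using n(1) k0 [OF that] by linarith
    finally show ?thesis using itinerary_iterate_late [of k k n s w] \<eta> by (simp add: b_def)
  qed
  have "\<forall>k. \<exists>x. height (b k) (n + k) x = y" using height_surj by blast
  then obtain X where X: "\<And>k. height (b k) (n + k) (X k) = y" by metis
  define S where "S k = height (b k) m (X k)" for k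
  have S0: "v < S k0"
  proof -
    have "height (b k0) (n - J) (X k0) \<le> height (b k0) (m + J) (X k0) - (real (n - J) - real (m + J)) / 66"
      using n J(1) by (intro height_down) (auto simp: b_def)
    moreover have "height (b k0) (m + J) (X k0) \<le> S k0 + J"
      using height_near [of m "m + J" "b k0" "X k0"] by (simp add: S_def)
    moreover have "y \<le> height (b k0) (n - J) (X k0) + (real (n + k0) - real (n - J))"
      using height_near [of "n - J" "n + k0" "b k0" "X k0"] X [of k0] diff_le_self [of n J] by linarith
    moreover have "real (n - J) = real n - J" using n by simp
    ultimately show ?thesis using n by (simp add: field_simps)
  qed
  \<comment> \<open>With \<open>n\<close> fixed, a larger \<open>k\<close> only lengthens the ascent
    near \<open>(0, 0)\<close>, so the height needed at time \<open>m\<close> to end at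
    \<open>y\<close> falls linearly in \<open>k\<close>.\<close>
  have S_le: "S k \<le> y + n + 2 * J - (real k - 2 * J) / 66" if "2 * J \<le> k" for k
  proof -
    have "height (b k) (n + J) (X k) + (real (n + (k - J)) - real (n + J)) / 66 \<le> height (b k) (n + (k - J)) (X k)"
    proof (rule height_up)
      fix l assume "n + J \<le> l" "l < n + (k - J)"
      then show "1 / 64 \<le> angle (b k) l" using J(2) [of "l - n" k n] by (simp add: b_def)
    qed (use that in auto)
    moreover have "S k \<le> height (b k) (n + J) (X k) + (real (n + J) - m)"
      using height_near [of m "n + J" "b k" "X k"] n by (simp add: S_def)
    moreover have "height (b k) (n + (k - J)) (X k) \<le> y + (real (n + k) - real (n + (k - J)))"
      using height_near [of "n + (k - J)" "n + k" "b k" "X k"] X by simp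
    moreover have "real (k - J) = real k - J" using that by simp
    ultimately show ?thesis by (simp add: field_simps)
  qed
  have "eventually (\<lambda>k. y + n + 2 * J - (real k - 2 * J) / 66 \<le> v) sequentially"
    using eventually_real_gt [of "66 * (y + n + 2 * J - v) + 2 * J"]
    by eventually_elim (simp add: field_simps)
  moreover have "eventually (\<lambda>k. k0 + 2 * J \<le> k) sequentially" by (rule eventually_ge_at_top)
  ultimately have "eventually (\<lambda>k. y + n + 2 * J - (real k - 2 * J) / 66 \<le> v \<and> k0 + 2 * J \<le> k) sequentially"
    by eventually_elim auto
  then obtain k1 where "y + n + 2 * J - (real k1 - 2 * J) / 66 \<le> v" "k0 + 2 * J \<le> k1"
    by (auto simp: eventually_sequentially)
  then have "k0 \<le> k1 \<and> S k1 \<le> v" using S_le [of k1] by auto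
  \<comment> \<open>At the first \<open>k\<close> with \<open>S k \<le> v\<close> the predecessor is
    above \<open>v\<close>, so a jump of at most \<open>v - u\<close> keeps \<open>S k\<close> above
    \<open>u\<close>.\<close>
  then obtain k where k: "k0 \<le> k" "S k \<le> v" "\<And>k'. k' < k \<Longrightarrow> \<not> (k0 \<le> k' \<and> S k' \<le> v)"
    using exists_least_iff [of "\<lambda>k. k0 \<le> k \<and> S k \<le> v"] by blast
  moreover have "k \<noteq> k0" using k S0 by auto
  ultimately obtain k' where k': "k = Suc k'" "k0 \<le> k'" by (cases k) auto
  then have "v < S k'" using k(3) [of k'] by auto
  moreover have "\<bar>S k' - S k\<bar> \<le> 1 + \<bar>w\<bar>"
    unfolding S_def k' b_def using n X [of k'] X [of k]
    by (intro backward_height_step [where y = y]) (auto simp: b_def k')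
  ultimately have "u < S k" using uv by linarith
  then have "height (b k) m lo < height (b k) m (X k)" "height (b k) m (X k) < height (b k) m hi"
    using bB [of k] k(2) by (auto simp: B0_def S_def)
  then have "lo < X k" "X k < hi" by (simp_all add: height_less_iff)
  moreover have "b k \<in> B" using bB [of k] by (simp add: B0_def)
  moreover have "0 < n + k" using n by simp
  ultimately show ?thesis using bC [OF k(1)] X [of k] by blast
qed

section \<open>Back to the slab\<close>

lemma slab_open_contains_box:
  assumes "openin (top_of_set slab) U" "U \<noteq> {}"
  obtains B lo hi where "open B" "B \<noteq> {}" "lo < hi"
    "\<And>b x. b \<in> B \<Longrightarrow> lo < x \<Longrightarrow> x < hi \<Longrightarrow> (b, logistic x) \<in> U"
proof -
  obtain T where T: "open T" "U = slab \<inter> T" using assms(1) by (auto simp: openin_open)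
  obtain b0 t0 where bt: "(b0, t0) \<in> U" using assms(2) by (metis ex_in_conv surj_pair)
  then have "(b0, t0) \<in> T" using T by simp
  with T(1) obtain B I where BI: "open B" "open I" "b0 \<in> B" "t0 \<in> I" "B \<times> I \<subseteq> T"
    by (rule open_prod_elim) auto
  \<comment> \<open>The point may lie on the boundary, where the logit coordinate is undefined;
    density of the open interval supplies an interior point nearby.\<close>
  have t0: "t0 \<in> closure {0<..<1}" using bt T by (auto simp: slab_def)
  have "I \<inter> {0<..<1} \<noteq> {}" using t0 BI(2,4) open_Int_closure_eq_empty [of I "{0<..<1::real}"] by auto
  then obtain t where t: "t \<in> I" "0 < t" "t < 1" by auto
  obtain x0 where x0: "logistic x0 = t" using logistic_surj [OF t(2,3)] by blast
  have "continuous_on UNIV logistic" unfolding logistic_def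
    by (intro continuous_intros) (metis add_pos_pos exp_gt_zero less_irrefl zero_less_one)
  then have "open (logistic -` I)" by (rule open_vimage [OF BI(2)])
  moreover have "x0 \<in> logistic -` I" using x0 t by simp
  ultimately obtain e where e: "0 < e" "ball x0 e \<subseteq> logistic -` I" by (rule openE)
  show ?thesis
  proof
    show "open B" "B \<noteq> {}" using BI by auto
    show "x0 - e < x0 + e" using e by simp
    fix b x assume "b \<in> B" "x0 - e < x" "x < x0 + e"
    then have "x \<in> ball x0 e" by (auto simp: dist_real_def)
    then have "(b, logistic x) \<in> T" using e BI \<open>b \<in> B\<close> by auto
    then show "(b, logistic x) \<in> U"
      using T logistic_bounds [of x] by (auto simp: slab_def less_imp_le)
  qed
qed

theorem corollary2:
  "slab_diffeomorphism skew_map \<and> topologically_transitive_on slab skew_map"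
proof
  show "slab_diffeomorphism skew_map" by (rule slab_diffeomorphism_skew_map)
  show "topologically_transitive_on slab skew_map"
    unfolding topologically_transitive_on_def
  proof (intro conjI allI impI)
    show "continuous_on slab skew_map" by (rule continuous_on_skew_map)
    show "skew_map ` slab \<subseteq> slab" using skew_map_slab by blast
    fix U V
    assume "openin (top_of_set slab) U \<and> U \<noteq> {} \<and> openin (top_of_set slab) V \<and> V \<noteq> {}"
    then have UV: "openin (top_of_set slab) U" "U \<noteq> {}" "openin (top_of_set slab) V" "V \<noteq> {}" by auto
    obtain B lo hi where B: "open B" "B \<noteq> {}" "lo < hi"
      "\<And>b x. b \<in> B \<Longrightarrow> lo < x \<Longrightarrow> x < hi \<Longrightarrow> (b, logistic x) \<in> U"
      using slab_open_contains_box [OF UV(1,2)] by blast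
    obtain C p q where C: "open C" "C \<noteq> {}" "p < q"
      "\<And>b x. b \<in> C \<Longrightarrow> p < x \<Longrightarrow> x < q \<Longrightarrow> (b, logistic x) \<in> V"
      using slab_open_contains_box [OF UV(3,4)] by blast
    \<comment> \<open>Reaching one exact height, the midpoint of the target interval, over any point
      of \<open>C\<close> is enough.\<close>
    obtain b x j where b: "b \<in> B" "0 < j" "lo < x" "x < hi" "(torus_auto ^^ j) b \<in> C" "height b j x = (p + q) / 2"
      using target_height_reached [OF B(1-3) C(1,2), of "(p + q) / 2"] by blast
    have "(skew_map ^^ j) (b, logistic x) \<in> V"
      unfolding skew_map_iterate b(6) using C(3) b(5) by (intro C(4)) auto
    moreover have "(b, logistic x) \<in> U" using b by (intro B(4))
    ultimately show "\<exists>m>0. (skew_map ^^ m) ` U \<inter> V \<noteq> {}" using b(2) by blast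
  qed
qed

end
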